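(* If $d,b_0,\dots,b_{n-1}$ is a modular sequence in a harmonic matroid $M$, then $n$ is a prime number and there are points $c_1,c_0,a_1,a_0$ in $M$ such that $h^\infty(\{d,b_0,b_1,c_1,c_0,a_1,a_0\})$ is a projective plane of order $n$.
   Context: Matroids may have an infinite ground set; $\operatorname{cl}$ denotes closure. Matroids are taken to be simple, so that "point" means element (for lattice-type examples, a rank-one flat); a set of points is collinear if it has rank at most $2$. For elements $y,x,z,o,q,r,s$ of a matroid $M$, $\mathrm{HP}(y,x,z;o,q,r,s)$ means that these are seven distinct elements and the restriction $M|\{y,x,z,o,q,r,s\}$ is a rank-3 matroid whose three-point lines are $\{y,x,z\},\{y,o,q\},\{y,r,s\},\{x,q,s\},\{z,o,s\},\{z,q,r\}$ and possibly also $\{x,o,r\}$, and no other set of three elements is collinear (so it is the non-Fano matroid $F_7^-$, or the Fano matroid $F_7$ if $\{x,o,r\}$ is collinear). For elements $y,x,z$ of $M$, a point $x'$ is a harmonic conjugate of $x$ with respect to $y$ and $z$, written $\mathrm{H}(y,z;x,x')$, if there are elements $o,q,r,s$ with $\mathrm{HP}(y,x,z;o,q,r,s)$ and $\operatorname{cl}(\{y,z\})\cap\operatorname{cl}(\{o,r\})=\{x'\}$. A harmonic matroid is a matroid such that every $\{y,x,z,o,q,r,s\}$ with $\mathrm{HP}(y,x,z;o,q,r,s)$ gives rise to such a harmonic conjugate $x'$, and $x'$ depends only on $x,y,z$ and not on the choice of $o,q,r,s$. For a subset $S$ of the ground set of a harmonic matroid $M$: $h(S)=S\cup\{x\in M: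 \mathrm{H}(a,c;b,x)\text{ for some }a,b,c\in S\}$, $h^n(S)=h(h^{n-1}(S))$ with $h^0(S)=S$, and $h^\infty(S)=\bigcup_{n\ge 0}h^n(S)$. A conjugate sequence is a sequence of points $A,a_0,a_1,\dots,a_n,\dots$ in a harmonic matroid with $\mathrm{H}(A,a_i;a_{i-1},a_{i+1})$ for all $i\ge 1$. It is modular if at least one of its points is equal to one of the preceding points. A modular sequence in which $a_n$ is the first point that is equal to one of its preceding points is denoted $A,a_0,a_1,\dots,a_{n-1}$. (So a modular sequence $d,b_0,\dots,b_{n-1}$ has $A=d$, $a_i=b_i$, with $b_n$ the first point equal to a preceding one.) A set $S$ of points "is a projective plane" means that $S$, with the lines of the restriction $M|S$, is a projective plane. *)

theory Defs
  imports Main "HOL-Library.Extended_Nat" "HOL-Computational_Algebra.Primes"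
begin

text \<open>
  Matroids on a possibly infinite ground set are finitary matroids, given by their closure operator;
  the operator is only meaningful on subsets of the ground set.
\<close>

record 'a matroid =
  ground :: "'a set"
  cl :: "'a set \<Rightarrow> 'a set"

definition is_matroid :: "'a matroid \<Rightarrow> bool" where
  "is_matroid M \<longleftrightarrow>
     (\<forall>X. X \<subseteq> ground M \<longrightarrow> X \<subseteq> cl M X \<and> cl M X \<subseteq> ground M) \<and>
     (\<forall>X Y. X \<subseteq> Y \<and> Y \<subseteq> ground M \<longrightarrow> cl M X \<subseteq> cl M Y) \<and>
     (\<forall>X. X \<subseteq> ground M \<longrightarrow> cl M (cl M X) = cl M X) \<and>
     (\<forall>X x y. X \<subseteq> ground M \<and> x \<in> ground M \<and> y \<in> ground M \<and>
        y \<in> cl M (insert x X) \<and> y \<notin> cl M X \<longrightarrow> x \<in> cl M (insert y X)) \<and>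
     (\<forall>X x. X \<subseteq> ground M \<and> x \<in> cl M X \<longrightarrow> (\<exists>F. finite F \<and> F \<subseteq> X \<and> x \<in> cl M F))"

definition simple_matroid :: "'a matroid \<Rightarrow> bool" where
  "simple_matroid M \<longleftrightarrow>
     is_matroid M \<and> cl M {} = {} \<and> (\<forall>x\<in>ground M. cl M {x} = {x})"

definition restriction :: "'a matroid \<Rightarrow> 'a set \<Rightarrow> 'a matroid" where
  "restriction M S = \<lparr>ground = S, cl = (\<lambda>X. cl M X \<inter> S)\<rparr>"

definition indep :: "'a matroid \<Rightarrow> 'a set \<Rightarrow> bool" where
  "indep M I \<longleftrightarrow> I \<subseteq> ground M \<and> (\<forall>x\<in>I. x \<notin> cl M (I - {x}))"

definition rank :: "'a matroid \<Rightarrow> 'a set \<Rightarrow> enat" where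
  "rank M X = (SUP I \<in> {I. I \<subseteq> X \<and> finite I \<and> indep M I}. enat (card I))"

definition collinear :: "'a matroid \<Rightarrow> 'a set \<Rightarrow> bool" where
  "collinear M X \<longleftrightarrow> X \<subseteq> ground M \<and> rank M X \<le> 2"

definition flat :: "'a matroid \<Rightarrow> 'a set \<Rightarrow> bool" where
  "flat M F \<longleftrightarrow> F \<subseteq> ground M \<and> cl M F = F"

definition lines :: "'a matroid \<Rightarrow> 'a set set" where
  "lines M = {L. flat M L \<and> rank M L = 2}"

definition three_point_lines :: "'a matroid \<Rightarrow> 'a set set" where
  "three_point_lines M = {L \<in> lines M. card L = 3}"

text \<open>
  \<open>HP M y x z p q r s\<close> is $\mathrm{HP}(y,x,z;o,q,r,s)$, with \<open>p\<close> in place of $o$ because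
  \<open>o\<close> is reserved for function composition.
\<close>

definition HP :: "'a matroid \<Rightarrow> 'a \<Rightarrow> 'a \<Rightarrow> 'a \<Rightarrow> 'a \<Rightarrow> 'a \<Rightarrow> 'a \<Rightarrow> 'a \<Rightarrow> bool" where
  "HP M y x z p q r s \<longleftrightarrow>
     distinct [y, x, z, p, q, r, s] \<and> {y, x, z, p, q, r, s} \<subseteq> ground M \<and>
     (let N = restriction M {y, x, z, p, q, r, s};
          T = {{y, x, z}, {y, p, q}, {y, r, s}, {x, q, s}, {z, p, s}, {z, q, r}}
      in rank N (ground N) = 3 \<and>
         (\<exists>T' \<in> {T, insert {x, p, r} T}.
            three_point_lines N = T' \<and>
            (\<forall>C. C \<subseteq> ground N \<and> card C = 3 \<and> C \<notin> T' \<longrightarrow> \<not> collinear N C)))"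

text \<open>\<open>harm_conj M y z x x'\<close> is $\mathrm{H}(y,z;x,x')$: the point \<open>x'\<close> is a harmonic
  conjugate of \<open>x\<close> with respect to \<open>y\<close> and \<open>z\<close>.\<close>

definition harm_conj :: "'a matroid \<Rightarrow> 'a \<Rightarrow> 'a \<Rightarrow> 'a \<Rightarrow> 'a \<Rightarrow> bool" where
  "harm_conj M y z x x' \<longleftrightarrow>
     (\<exists>p q r s. HP M y x z p q r s \<and> cl M {y, z} \<inter> cl M {p, r} = {x'})"

definition harmonic_matroid :: "'a matroid \<Rightarrow> bool" where
  "harmonic_matroid M \<longleftrightarrow>
     simple_matroid M \<and>
     (\<forall>y x z p q r s. HP M y x z p q r s \<longrightarrow> (\<exists>x'. cl M {y, z} \<inter> cl M {p, r} = {x'})) \<and>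
     (\<forall>y x z x1 x2. harm_conj M y z x x1 \<and> harm_conj M y z x x2 \<longrightarrow> x1 = x2)"

definition harm_step :: "'a matroid \<Rightarrow> 'a set \<Rightarrow> 'a set" where
  "harm_step M S = S \<union> {x \<in> ground M. \<exists>a\<in>S. \<exists>b\<in>S. \<exists>c\<in>S. harm_conj M a c b x}"

definition harm_closure :: "'a matroid \<Rightarrow> 'a set \<Rightarrow> 'a set" where
  "harm_closure M S = (\<Union>n. (harm_step M ^^ n) S)"

definition conjugate_sequence :: "'a matroid \<Rightarrow> 'a \<Rightarrow> (nat \<Rightarrow> 'a) \<Rightarrow> bool" where
  "conjugate_sequence M A a \<longleftrightarrow>
     A \<in> ground M \<and> range a \<subseteq> ground M \<and>
     (\<forall>i\<ge>1. harm_conj M A (a i) (a (i - 1)) (a (i + 1)))"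

definition repeats_at :: "'a \<Rightarrow> (nat \<Rightarrow> 'a) \<Rightarrow> nat \<Rightarrow> bool" where
  "repeats_at A a n \<longleftrightarrow> a n \<in> insert A (a ` {..<n})"

text \<open>
  \<open>modular_sequence M A a n\<close>: the (infinite) conjugate sequence \<open>A, a 0, a 1, \<dots>\<close> is modular
  and \<open>a n\<close> is its first repeated point, so that it is denoted by \<open>A, a 0, \<dots>, a (n - 1)\<close>.
\<close>

definition modular_sequence :: "'a matroid \<Rightarrow> 'a \<Rightarrow> (nat \<Rightarrow> 'a) \<Rightarrow> nat \<Rightarrow> bool" where
  "modular_sequence M A a n \<longleftrightarrow>
     conjugate_sequence M A a \<and> repeats_at A a n \<and> (\<forall>m<n. \<not> repeats_at A a m)"

definition projective_plane :: "'a set \<Rightarrow> 'a set set \<Rightarrow> bool" where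
  "projective_plane P \<L> \<longleftrightarrow>
     (\<forall>L\<in>\<L>. L \<subseteq> P) \<and>
     (\<forall>x\<in>P. \<forall>y\<in>P. x \<noteq> y \<longrightarrow> (\<exists>!L. L \<in> \<L> \<and> x \<in> L \<and> y \<in> L)) \<and>
     (\<forall>L\<in>\<L>. \<forall>K\<in>\<L>. L \<noteq> K \<longrightarrow> (\<exists>!x. x \<in> L \<and> x \<in> K)) \<and>
     (\<exists>Q\<subseteq>P. card Q = 4 \<and> (\<forall>L\<in>\<L>. card (Q \<inter> L) \<le> 2))"

definition projective_plane_of_order :: "nat \<Rightarrow> 'a set \<Rightarrow> 'a set set \<Rightarrow> bool" where
  "projective_plane_of_order n P \<L> \<longleftrightarrow>
     projective_plane P \<L> \<and> (\<forall>L\<in>\<L>. finite L \<and> card L = n + 1)"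

definition is_projective_plane_of_order :: "'a matroid \<Rightarrow> 'a set \<Rightarrow> nat \<Rightarrow> bool" where
  "is_projective_plane_of_order M S n \<longleftrightarrow>
     projective_plane_of_order n S (lines (restriction M S))"

end

theory Submission imports Defs begin

text \<open>
  In a projective plane over the field with \<open>p\<close> elements, let \<open>d\<close> be the point at infinity of the
  horizontal lines and \<open>b t = (t, 0)\<close>. Then \<open>b (t + 1)\<close> is the harmonic conjugate of \<open>b (t - 1)\<close>
  with respect to \<open>d\<close> and \<open>b t\<close>, so \<open>d, b 0, \<dots>, b (p - 1)\<close> is a modular sequence. The theorem says
  that every modular sequence arises in this way, and the proof reconstructs the coordinates.
  The obstacle is that two lines of a plane of \<open>M\<close> need not meet. Every point of intersection has to be
  obtained from a quadrangle to which the harmonic axiom applies (\<open>HP_I\<close>, \<open>harm_conj_meet\<close>),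
  and incidences are carried from one quadrangle to another by the uniqueness of the conjugate.

  The quadrangle of the first conjugation gives two more lines through \<open>d\<close>, which play the role of the row
  of ordinate \<open>1\<close> and of the line at infinity. Projections between the three lines shift the
  sequence by one step (\<open>translate\<close>). This produces sequences of points \<open>c k\<close> and \<open>a i\<close> on the two lines
  such that \<open>a i\<close>, \<open>b (i + k)\<close>, \<open>c k\<close> are collinear, and it shows that the first repetition is
  \<open>b n = b 0\<close> (\<open>coordinate_frame_of_modular\<close>).

  The remaining points \<open>(t, u)\<close> are built row by row. The point \<open>(t, u + 1)\<close> is the conjugate of
  \<open>(t, u - 1)\<close> with respect to the vertical direction \<open>a 0\<close> and \<open>(t, u)\<close>. Each direction \<open>a j\<close> gives another
  quadrangle for this conjugate, so the conjugate lies on the lines of all slopes (\<open>row_next\<close>). This step uses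
  that the previous two rows are collinear with \<open>d\<close>. For odd \<open>n\<close> the new row inherits that property:
  the triple \<open>(i, v), (i + k, v), (i + 2k, v)\<close> has conjugate point \<open>d\<close>, and a quadrangle with two points in
  row \<open>v + 2\<close> has the same triple (\<open>row_line_next\<close>).

  A point \<open>(0, u)\<close> with \<open>n = u * k\<close> would coincide with \<open>b 0\<close>, since two different lines pass through both of them
  (\<open>no_factor\<close>). Row \<open>2\<close> excludes even \<open>n > 2\<close>, and the higher rows exclude composite odd \<open>n\<close>.
  So \<open>n\<close> is prime, linear congruences modulo \<open>n\<close> are solvable, and the constructed points form a
  projective plane of order \<open>n\<close>. A projective plane in \<open>M\<close> is closed under harmonic conjugation
  (\<open>projective_plane_harm_closed\<close>), and all its points were obtained by conjugation from the seven initial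
  ones. Hence it is their harmonic closure.
\<close>

section \<open>Rank and lines\<close>

text \<open>A simple matroid is used only through its lines: two distinct points lie on exactly one line, so
two distinct lines share at most one point. The lemmas of this part extract this linear space, and
that of a restriction, from the closure operator. Two distinct lines of one plane need not meet.\<close>

locale simple_mat =
  fixes M :: "'a matroid"
  assumes simple: "simple_matroid M"
begin

abbreviation "E \<equiv> ground M"
abbreviation "clo \<equiv> cl M"

lemma mat: "is_matroid M"
  using simple by (simp add: simple_matroid_def)

lemmas matroid_axioms = mat[unfolded is_matroid_def]

lemma cl_ext: "X \<subseteq> E \<Longrightarrow> X \<subseteq> clo X"
  and cl_ground: "X \<subseteq> E \<Longrightarrow> clo X \<subseteq> E"
  using matroid_axioms[THEN conjunct1] by blast+

lemma cl_mono: "X \<subseteq> Y \<Longrightarrow> Y \<subseteq> E \<Longrightarrow> clo X \<subseteq> clo Y"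
  using matroid_axioms[THEN conjunct2, THEN conjunct1] by blast

lemma cl_idem: "X \<subseteq> E \<Longrightarrow> clo (clo X) = clo X"
  using matroid_axioms[THEN conjunct2, THEN conjunct2, THEN conjunct1] by blast

lemma cl_exchange:
  "X \<subseteq> E \<Longrightarrow> x \<in> E \<Longrightarrow> y \<in> E \<Longrightarrow> y \<in> clo (insert x X) \<Longrightarrow> y \<notin> clo X \<Longrightarrow> x \<in> clo (insert y X)"
  using matroid_axioms[THEN conjunct2, THEN conjunct2, THEN conjunct2, THEN conjunct1] by blast

lemma cl_finitary: "X \<subseteq> E \<Longrightarrow> x \<in> clo X \<Longrightarrow> \<exists>F. finite F \<and> F \<subseteq> X \<and> x \<in> clo F"
  using matroid_axioms[THEN conjunct2, THEN conjunct2, THEN conjunct2, THEN conjunct2] by blast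

lemma cl_least: "X \<subseteq> clo Y \<Longrightarrow> Y \<subseteq> E \<Longrightarrow> clo X \<subseteq> clo Y"
  using cl_mono[of X "clo Y"] cl_idem[of Y] cl_ground[of Y] by blast

lemma indep_insert:
  assumes "indep M I" "y \<in> E" "y \<notin> clo I"
  shows "indep M (insert y I)"
proof -
  have I: "I \<subseteq> E" "\<And>x. x \<in> I \<Longrightarrow> x \<notin> clo (I - {x})"
    using assms(1) by (auto simp: indep_def)
  have y: "y \<notin> I" using assms(3) cl_ext[OF I(1)] by blast
  have "x \<notin> clo (insert y I - {x})" if x: "x \<in> insert y I" for x
  proof (cases "x = y")
    case True then show ?thesis using y assms(3) by simp
  next
    case False
    then have xI: "x \<in> I" using x by simp
    have e: "insert y I - {x} = insert y (I - {x})" "insert x (I - {x}) = I"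
      using False xI by auto
    show ?thesis
      using cl_exchange[of "I - {x}" y x] I xI assms(2,3) e by auto
  qed
  then show ?thesis using I(1) assms(2) by (simp add: indep_def)
qed

text \<open>Steinitz exchange: an element of \<open>I\<close> outside \<open>J\<close> can be traded for an element of \<open>J\<close>
  that the rest of \<open>I\<close> does not span, until \<open>I\<close> lies inside \<open>J\<close>.\<close>

lemma steinitz:
  assumes "finite J" "J \<subseteq> E" "finite I" "indep M I" "I \<subseteq> clo J"
  shows "card I \<le> card J"
  using assms(3-5)
proof (induction "card (I - J)" arbitrary: I rule: less_induct)
  case less
  show ?case
  proof (cases "I \<subseteq> J")
    case True then show ?thesis using assms(1) by (simp add: card_mono)
  next
    case False
    then obtain x where x: "x \<in> I" "x \<notin> J" by blast
    let ?I = "I - {x}"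
    have IE: "I \<subseteq> E" and xn: "x \<notin> clo ?I"
      using less.prems(2) x by (auto simp: indep_def)
    have "\<not> J \<subseteq> clo ?I"
      using cl_least[of J ?I] IE less.prems(3) x xn by blast
    then obtain y where y: "y \<in> J" "y \<notin> clo ?I" by blast
    have yI: "y \<notin> ?I" using y cl_ext[of ?I] IE by blast
    have "indep M ?I" unfolding indep_def
    proof (intro conjI ballI)
      show "?I \<subseteq> E" using IE by blast
      fix w assume w: "w \<in> ?I"
      have "clo (?I - {w}) \<subseteq> clo (I - {w})" using IE by (intro cl_mono) auto
      then show "w \<notin> clo (?I - {w})" using less.prems(2) w by (auto simp: indep_def)
    qed
    then have "indep M (insert y ?I)" using y assms(2) by (intro indep_insert) auto
    moreover have "insert y ?I \<subseteq> clo J" using less.prems(3) y cl_ext[OF assms(2)] by blast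
    moreover have "card (insert y ?I - J) < card (I - J)"
      using x y less.prems(1) by (intro psubset_card_mono) auto
    ultimately have "card (insert y ?I) \<le> card J" using less by simp
    then show ?thesis using yI less.prems(1) x by (simp add: card_Suc_Diff1)
  qed
qed

lemma rank_le:
  assumes "finite J" "J \<subseteq> E" "X \<subseteq> clo J" "card J \<le> k"
  shows "rank M X \<le> enat k"
  unfolding rank_def
proof (rule SUP_least)
  fix I assume "I \<in> {I. I \<subseteq> X \<and> finite I \<and> indep M I}"
  then have "card I \<le> card J" using assms by (intro steinitz) auto
  then show "enat (card I) \<le> enat k" using assms(4) by simp
qed

lemma rank_ge:
  assumes "I \<subseteq> X" "finite I" "indep M I"
  shows "enat (card I) \<le> rank M X"
  unfolding rank_def using assms by (intro SUP_upper CollectI conjI)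

lemma indep_empty: "indep M {}" by (simp add: indep_def)

lemma indep_pair:
  assumes "u \<in> E" "v \<in> E" "u \<noteq> v"
  shows "indep M {u, v}"
proof -
  have "indep M {v}" using indep_insert[OF indep_empty, of v] simple assms
    by (auto simp: simple_matroid_def)
  moreover have "u \<notin> clo {v}" using simple assms by (auto simp: simple_matroid_def)
  ultimately show ?thesis using indep_insert assms by blast
qed

lemma indep_triple:
  assumes "u \<in> E" "v \<in> E" "u \<noteq> v" "w \<in> E" "w \<notin> clo {u, v}"
  shows "indep M {w, u, v}"
  using assms by (intro indep_insert indep_pair)

lemma rank_gt2:
  assumes "{u, v, w} \<subseteq> X" "u \<in> E" "v \<in> E" "u \<noteq> v" "w \<in> E" "w \<notin> clo {u, v}"
  shows "3 \<le> rank M X"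
proof -
  have "w \<notin> {u, v}" using cl_ext[of "{u, v}"] assms by auto
  then have "card {w, u, v} = 3" using assms by simp
  moreover have "enat (card {w, u, v}) \<le> rank M X"
    using assms by (intro rank_ge indep_triple) auto
  ultimately show ?thesis by (simp add: enat_numeral)
qed

lemma line_through:
  assumes "u \<in> E" "v \<in> E" "u \<noteq> v"
  shows "clo {u, v} \<in> lines M"
proof -
  have s: "{u, v} \<subseteq> E" using assms by simp
  have "rank M (clo {u, v}) \<le> enat 2" using assms by (intro rank_le[of "{u, v}"]) auto
  moreover have "enat 2 \<le> rank M (clo {u, v})"
    using rank_ge[of "{u, v}" "clo {u, v}"] indep_pair[OF assms] assms cl_ext[OF s]
    by (simp add: numeral_2_eq_2)
  ultimately have "rank M (clo {u, v}) = 2" by (simp add: enat_numeral)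
  then show ?thesis using s cl_ground cl_idem by (simp add: lines_def flat_def)
qed

lemma line_ground: "l \<in> lines M \<Longrightarrow> x \<in> l \<Longrightarrow> x \<in> E"
  by (auto simp: lines_def flat_def)

lemma line_eq_cl:
  assumes "l \<in> lines M" "u \<in> l" "v \<in> l" "u \<noteq> v"
  shows "l = clo {u, v}"
proof
  have l: "l \<subseteq> E" "clo l = l" "rank M l = 2" using assms(1) by (auto simp: lines_def flat_def)
  show "clo {u, v} \<subseteq> l" using cl_mono[of "{u, v}" l] l assms by auto
  show "l \<subseteq> clo {u, v}"
  proof
    fix w assume "w \<in> l"
    then show "w \<in> clo {u, v}" using rank_gt2[of u v w l] l assms by auto
  qed
qed

lemma line_two_points:
  assumes "l \<in> lines M"
  obtains u v where "u \<in> l" "v \<in> l" "u \<noteq> v" "l = clo {u, v}"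
proof -
  have l: "l \<subseteq> E" "rank M l = 2" using assms by (auto simp: lines_def flat_def)
  have "\<exists>u\<in>l. \<exists>v\<in>l. u \<noteq> v"
  proof (rule ccontr)
    assume "\<not> ?thesis"
    then have "l \<subseteq> {SOME u. u \<in> l}" by (metis insertI1 someI subsetI)
    then have "finite l" "card l \<le> 1"
      using finite_subset[of l "{SOME u. u \<in> l}"] card_mono[of "{SOME u. u \<in> l}" l] by auto
    then have "rank M l \<le> enat 1" using l cl_ext[of l] by (intro rank_le[of l]) auto
    then show False using l(2) by (simp add: one_enat_def[symmetric])
  qed
  then show ?thesis using that line_eq_cl[OF assms] by blast
qed

lemma line_unique:
  "l \<in> lines M \<Longrightarrow> k \<in> lines M \<Longrightarrow> u \<in> l \<Longrightarrow> v \<in> l \<Longrightarrow> u \<in> k \<Longrightarrow> v \<in> k \<Longrightarrow> u \<noteq> v \<Longrightarrow> l = k"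
  using line_eq_cl by metis

text \<open>A dependent triple of distinct points \<open>u, v, w\<close> has \<open>w\<close> in the closure of \<open>{u, v}\<close>; otherwise
exchange would make it independent, of rank \<open>3\<close>.\<close>

lemma collinear_iff_line:
  assumes "card C = 3"
  shows "collinear M C \<longleftrightarrow> (\<exists>l\<in>lines M. C \<subseteq> l)"
proof
  assume c: "collinear M C"
  obtain u v w where C: "C = {u, v, w}" "u \<noteq> v" using assms by (auto simp: card_3_iff)
  have e: "u \<in> E" "v \<in> E" "w \<in> E" "rank M C \<le> 2" using c C by (auto simp: collinear_def)
  then have "w \<in> clo {u, v}"
    using rank_gt2[of u v w C] C order.trans[of 3 "rank M C" 2] by auto
  then show "\<exists>l\<in>lines M. C \<subseteq> l"
    using line_through[of u v] e C cl_ext[of "{u, v}"] by auto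
next
  assume "\<exists>l\<in>lines M. C \<subseteq> l"
  then obtain l where l: "l \<in> lines M" "C \<subseteq> l" by blast
  obtain u v where uv: "u \<in> l" "v \<in> l" "u \<noteq> v" "l = clo {u, v}"
    using line_two_points[OF l(1)] .
  have "u \<in> E" "v \<in> E" "C \<subseteq> E" using uv l line_ground by blast+
  then show "collinear M C"
    using rank_le[of "{u, v}" C 2] uv l by (simp add: collinear_def enat_numeral)
qed

lemma simple_restriction:
  assumes "S \<subseteq> E"
  shows "simple_mat (restriction M S)"
proof
  have ext: "X \<subseteq> clo X \<inter> S \<and> clo X \<inter> S \<subseteq> S" if "X \<subseteq> S" for X
    using cl_ext[of X] that assms by blast
  have mono: "clo X \<inter> S \<subseteq> clo Y \<inter> S" if "X \<subseteq> Y \<and> Y \<subseteq> S" for X Y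
    using cl_mono[of X Y] that assms by blast
  have idem: "clo (clo X \<inter> S) \<inter> S = clo X \<inter> S" if "X \<subseteq> S" for X
  proof -
    have "X \<subseteq> E" "X \<subseteq> clo X \<inter> S" "clo X \<inter> S \<subseteq> E" using ext[OF that] that assms by auto
    then have "clo (clo X \<inter> S) = clo X"
      using cl_least[of "clo X \<inter> S" X] cl_mono[of X "clo X \<inter> S"] by blast
    then show ?thesis by simp
  qed
  have exch: "x \<in> clo (insert y X) \<inter> S"
    if "X \<subseteq> S \<and> x \<in> S \<and> y \<in> S \<and> y \<in> clo (insert x X) \<inter> S \<and> y \<notin> clo X \<inter> S" for X x y
    using cl_exchange[of X x y] that assms by blast
  have fin: "\<exists>F. finite F \<and> F \<subseteq> X \<and> x \<in> clo F \<inter> S" if "X \<subseteq> S \<and> x \<in> clo X \<inter> S" for X x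
    using cl_finitary[of X x] that assms by blast
  have "is_matroid (restriction M S)"
    unfolding is_matroid_def restriction_def matroid.simps
    proof (intro conjI)
    show "\<forall>X. X \<subseteq> S \<longrightarrow> X \<subseteq> clo X \<inter> S \<and> clo X \<inter> S \<subseteq> S" using ext by (intro allI impI)
    show "\<forall>X Y. X \<subseteq> Y \<and> Y \<subseteq> S \<longrightarrow> clo X \<inter> S \<subseteq> clo Y \<inter> S" using mono by (intro allI impI)
    show "\<forall>X. X \<subseteq> S \<longrightarrow> clo (clo X \<inter> S) \<inter> S = clo X \<inter> S" using idem by (intro allI impI)
    show "\<forall>X x y. X \<subseteq> S \<and> x \<in> S \<and> y \<in> S \<and> y \<in> clo (insert x X) \<inter> S \<and> y \<notin> clo X \<inter> S
      \<longrightarrow> x \<in> clo (insert y X) \<inter> S" using exch by (intro allI impI)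
    show "\<forall>X x. X \<subseteq> S \<and> x \<in> clo X \<inter> S \<longrightarrow> (\<exists>F. finite F \<and> F \<subseteq> X \<and> x \<in> clo F \<inter> S)"
      using fin by (intro allI impI)
  qed
  then show "simple_matroid (restriction M S)"
    using simple assms subsetD[OF assms] by (simp add: simple_matroid_def restriction_def)
qed

lemma lines_restriction:
  assumes "S \<subseteq> E"
  shows "lines (restriction M S) = {l \<inter> S | l u v. l \<in> lines M \<and> u \<in> l \<inter> S \<and> v \<in> l \<inter> S \<and> u \<noteq> v}"
    (is "_ = ?R")
proof -
  interpret N: simple_mat "restriction M S" using assms by (rule simple_restriction)
  have N [simp]: "ground (restriction M S) = S" "cl (restriction M S) X = clo X \<inter> S" for X
    by (simp_all add: restriction_def)
  show ?thesis
  proof (intro subset_antisym subsetI)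
    fix L assume L: "L \<in> lines (restriction M S)"
    obtain u v where "u \<in> L" "v \<in> L" "u \<noteq> v" "L = cl (restriction M S) {u, v}"
      using N.line_two_points[OF L] .
    then have uv: "u \<in> L" "v \<in> L" "u \<noteq> v" "L = clo {u, v} \<inter> S" by simp_all
    then have "clo {u, v} \<in> lines M" using line_through assms by blast
    then show "L \<in> ?R" using uv by blast
  next
    fix L assume "L \<in> ?R"
    then obtain l u v where *: "L = l \<inter> S" "l \<in> lines M" "u \<in> l \<inter> S" "v \<in> l \<inter> S" "u \<noteq> v" by blast
    then have "l = clo {u, v}" using line_eq_cl by blast
    then show "L \<in> lines (restriction M S)" using N.line_through[of u v] * by simp
  qed
qed

lemma collinear_restriction:
  assumes "S \<subseteq> E" "C \<subseteq> S" "card C = 3"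
  shows "collinear (restriction M S) C \<longleftrightarrow> (\<exists>l\<in>lines M. C \<subseteq> l)"
proof -
  interpret N: simple_mat "restriction M S" using assms(1) by (rule simple_restriction)
  obtain u v where uv: "u \<in> C" "v \<in> C" "u \<noteq> v" using assms(3) by (auto simp: card_3_iff)
  show ?thesis unfolding N.collinear_iff_line[OF assms(3)] lines_restriction[OF assms(1)]
  proof
    assume "\<exists>l\<in>lines M. C \<subseteq> l"
    then obtain l where l: "l \<in> lines M" "C \<subseteq> l" by blast
    then have "u \<in> l \<inter> S" "v \<in> l \<inter> S" "C \<subseteq> l \<inter> S" using uv assms(2) by auto
    then show "\<exists>L\<in>{l \<inter> S | l u v. l \<in> lines M \<and> u \<in> l \<inter> S \<and> v \<in> l \<inter> S \<and> u \<noteq> v}. C \<subseteq> L"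
      using l(1) uv(3)
      by (intro bexI[of _ "l \<inter> S"] CollectI exI[of _ l] exI[of _ u] exI[of _ v] conjI refl) simp_all
  qed blast
qed

end

section \<open>Harmonic quadrangles\<close>

locale harmonic =
  fixes M :: "'a matroid"
  assumes harmonic: "harmonic_matroid M"

sublocale harmonic \<subseteq> simple_mat
  using harmonic by unfold_locales (simp add: harmonic_matroid_def)

context harmonic
begin

lemma line_subset_cl:
  assumes "l \<in> lines M" "u \<in> l" "v \<in> l" "u \<noteq> v" "u \<in> clo J" "v \<in> clo J" "J \<subseteq> E"
  shows "l \<subseteq> clo J"
  using line_eq_cl[OF assms(1-4)] cl_least[of "{u, v}" J] assms by simp

text \<open>This form of \<open>HP\<close> is the one that can be checked in practice: two lines through \<open>y\<close>, two further
points on each, and four lines that carry the remaining incidences. All the non-collinearities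
demanded by \<open>HP\<close> follow, because any other coincidence among the seven points forces two of the six
lines to share two points, and these coincidences end in the two lines through \<open>y\<close> being equal.\<close>

lemma HP_I:
  assumes l: "l1 \<in> lines M" "l2 \<in> lines M" "l3 \<in> lines M" "l4 \<in> lines M" "l5 \<in> lines M" "l6 \<in> lines M"
    and i1: "y \<in> l1" "p \<in> l1" "q \<in> l1" and i2: "y \<in> l2" "r \<in> l2" "s \<in> l2"
    and i3: "z \<in> l3" "p \<in> l3" "s \<in> l3" and i4: "z \<in> l4" "q \<in> l4" "r \<in> l4"
    and i5: "x \<in> l5" "y \<in> l5" "z \<in> l5" and i6: "x \<in> l6" "q \<in> l6" "s \<in> l6"
    and ne: "l1 \<noteq> l2" "y \<noteq> p" "y \<noteq> q" "p \<noteq> q" "y \<noteq> r" "y \<noteq> s" "r \<noteq> s"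
  shows "HP M y x z p q r s"
proof -
  let ?S = "{y, x, z, p, q, r, s}"
  note U = line_unique
  have a1: "r \<notin> l1" "s \<notin> l1" and a2: "p \<notin> l2" "q \<notin> l2"
    using U[OF l(1,2)] i1 i2 ne by metis+
  have b3: "q \<notin> l3" "r \<notin> l3"
    using U[OF l(1,3)] U[OF l(2,3)] i1 i2 i3 ne a1 a2 by metis+
  have b4: "p \<notin> l4" "s \<notin> l4"
    using U[OF l(1,4)] U[OF l(2,4)] i1 i2 i4 ne a1 a2 by metis+
  have b6: "p \<notin> l6" "r \<notin> l6"
    using U[OF l(1,6)] U[OF l(2,6)] i1 i2 i6 ne a1 a2 by metis+
  have z1: "z \<notin> l1" and z2: "z \<notin> l2"
    using U[OF l(1,3)] U[OF l(2,3)] i1 i2 i3 i4 a1 a2 b3 b4 by metis+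
  have y3: "y \<notin> l3" and y4: "y \<notin> l4"
    using U[OF l(1,3)] U[OF l(2,4)] i1 i2 i3 i4 a1 a2 ne by metis+
  have b5: "p \<notin> l5" "q \<notin> l5" "r \<notin> l5" "s \<notin> l5"
    using U[OF l(1,5)] U[OF l(2,5)] i1 i2 i5 ne z1 z2 by metis+
  have x1: "x \<notin> l1" and x2: "x \<notin> l2" and x3: "x \<notin> l3" and x4: "x \<notin> l4"
    using U[OF l(1,6)] U[OF l(2,6)] U[OF l(3,6)] U[OF l(4,6)] i1 i2 i3 i4 i5 i6 a1 a2 b3 b4 b5
    by metis+
  have y6: "y \<notin> l6" and z6: "z \<notin> l6"
    using U[OF l(1,6)] U[OF l(4,6)] i1 i4 i6 a1 b4 b3 i3 ne by metis+
  have dist: "distinct [y, x, z, p, q, r, s]"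
    using i1 i2 i3 i4 i5 i6 ne a1 a2 b3 b4 b6 z1 z2 y3 y4 b5 x1 x2 x3 x4 y6 z6
    by auto
  have SE: "?S \<subseteq> E" using line_ground l i1 i2 i3 i5 by blast
  have t: "l1 \<inter> ?S = {y, p, q}" "l2 \<inter> ?S = {y, r, s}" "l3 \<inter> ?S = {z, p, s}"
    "l4 \<inter> ?S = {z, q, r}" "l5 \<inter> ?S = {y, x, z}" "l6 \<inter> ?S = {x, q, s}"
    using i1 i2 i3 i4 i5 i6 a1 a2 b3 b4 b6 z1 z2 y3 y4 b5 x1 x2 x3 x4 y6 z6 by auto
  define T where "T = {{y, x, z}, {y, p, q}, {y, r, s}, {x, q, s}, {z, p, s}, {z, q, r}}"
  define N where "N = restriction M ?S"
  define T' where "T' = (if \<exists>l\<in>lines M. {x, p, r} \<subseteq> l then insert {x, p, r} T else T)"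
  interpret N: simple_mat N unfolding N_def using SE by (rule simple_restriction)
  have N [simp]: "ground N = ?S" "cl N X = clo X \<inter> ?S" for X
    by (simp_all add: N_def restriction_def)
  have Tl: "\<exists>l\<in>lines M. l \<inter> ?S = C" if "C \<in> T'" for C
  proof (cases "C \<in> T")
    case True
    then show ?thesis using t l unfolding T_def by blast
  next
    case False
    then have C: "C = {x, p, r}" and "\<exists>k\<in>lines M. {x, p, r} \<subseteq> k"
      using that unfolding T'_def by (auto split: if_splits)
    then obtain k where k: "k \<in> lines M" "x \<in> k" "p \<in> k" "r \<in> k" by auto
    have ds: "x \<noteq> p" "x \<noteq> r" "p \<noteq> r" using dist by auto
    have "k \<noteq> l1" "k \<noteq> l2" "k \<noteq> l3" using k a1 a2 b3 by auto
    then have "y \<notin> k" "q \<notin> k" "s \<notin> k" "z \<notin> k"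
      using U[OF k(1) l(1)] U[OF k(1) l(2)] U[OF k(1) l(3)] k i1 i2 i3 ne z1 by metis+
    then have "k \<inter> ?S = C" using k C by auto
    then show ?thesis using k(1) by blast
  qed
  have card3: "card C = 3" if "C \<in> T'" for C
  proof -
    have "\<forall>C\<in>insert {x, p, r} T. card C = 3" unfolding T_def using dist by simp
    then show ?thesis using that by (auto simp: T'_def split: if_splits)
  qed
  have lT: "C \<in> T'" if C: "C \<subseteq> ?S" "card C = 3" "k \<in> lines M" "C \<subseteq> k" for C k
  proof -
    \<comment> \<open>A line with one of the prescribed traces contains no triple except that trace.\<close>
    have *: "C \<in> T'" if "k \<inter> ?S = D" "D \<in> T" for D
    proof -
      have D: "D \<in> T'" using that(2) by (simp add: T'_def)
      then have "finite D" "card D = 3" using card3 card.infinite[of D] by fastforce+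
      moreover have "C \<subseteq> D" using C that by blast
      ultimately have "C = D" using C(2) by (simp add: card_subset_eq)
      then show ?thesis using D by simp
    qed
    show ?thesis
    proof (cases "k \<in> {l1, l2, l3, l4, l5, l6}")
      case True
      then show ?thesis using * t unfolding T_def by blast
    next
      case False
      \<comment> \<open>Any other line takes at most one point from each of the six lines. Each of \<open>y, z, q, s\<close> is joined to
        all other points by three of the six lines, so only \<open>{x, p, r}\<close> can be a collinear triple.\<close>
      have V: "u = v" if "u \<in> C" "v \<in> C" "m \<in> {l1, l2, l3, l4, l5, l6}" "u \<in> m" "v \<in> m" for u v m
      proof (rule ccontr)
        assume "u \<noteq> v"
        moreover have "m \<in> lines M" using that(3) l by auto
        ultimately have "k = m" using U[OF C(3)] C(4) that by blast
        then show False using that(3) False by simp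
      qed
      have single: "w \<notin> C" if "C \<subseteq> {w}" for w
        using card_mono[OF _ that] C(2) by simp
      have "y \<notin> C"
      proof
        assume "y \<in> C"
        then have "w = y" if "w \<in> C" for w using V[of y w l1] V[of y w l2] V[of y w l5] that C(1) i1 i2 i5
          by auto
        then show False using single[of y] \<open>y \<in> C\<close> by blast
      qed
      moreover have "z \<notin> C"
      proof
        assume "z \<in> C"
        then have "w = z" if "w \<in> C" for w using V[of z w l3] V[of z w l4] V[of z w l5] that C(1) i3 i4 i5
          by auto
        then show False using single[of z] \<open>z \<in> C\<close> by blast
      qed
      moreover have "q \<notin> C"
      proof
        assume "q \<in> C"
        then have "w = q" if "w \<in> C" for w using V[of q w l1] V[of q w l4] V[of q w l6] that C(1) i1 i4 i6
          by auto
        then show False using single[of q] \<open>q \<in> C\<close> by blast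
      qed
      moreover have "s \<notin> C"
      proof
        assume "s \<in> C"
        then have "w = s" if "w \<in> C" for w using V[of s w l2] V[of s w l3] V[of s w l6] that C(1) i2 i3 i6
          by auto
        then show False using single[of s] \<open>s \<in> C\<close> by blast
      qed
      ultimately have "C \<subseteq> {x, p, r}" using C(1) by auto
      moreover have "card {x, p, r} = 3" using dist by simp
      ultimately have "C = {x, p, r}" using C(2) by (simp add: card_subset_eq)
      then show ?thesis using C(3,4) unfolding T'_def by auto
    qed
  qed
  have "three_point_lines N = T'"
  proof (intro subset_antisym subsetI)
    fix L assume "L \<in> three_point_lines N"
    then have L: "L \<in> lines N" "card L = 3" by (auto simp: three_point_lines_def)
    then obtain k where "k \<in> lines M" "L = k \<inter> ?S"
      unfolding N_def lines_restriction[OF SE] by blast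
    then show "L \<in> T'" using lT[of L k] L(2) by blast
  next
    fix L assume L: "L \<in> T'"
    then obtain k where k: "k \<in> lines M" "k \<inter> ?S = L" using Tl by blast
    obtain u v where "u \<in> L" "v \<in> L" "u \<noteq> v" using card3[OF L] by (auto simp: card_3_iff)
    then have "L \<in> lines N" unfolding N_def lines_restriction[OF SE] using k by blast
    then show "L \<in> three_point_lines N" using card3[OF L] by (simp add: three_point_lines_def)
  qed
  moreover have "\<not> collinear N C" if "C \<subseteq> ?S" "card C = 3" "C \<notin> T'" for C
    using collinear_restriction[OF SE that(1,2)] lT that unfolding N_def by blast
  moreover have "rank N ?S = 3"
  proof -
    have pqr: "{p, q, r} \<subseteq> E" using SE by auto
    have c: "{p, q, r} \<subseteq> clo {p, q, r}" using cl_ext[OF pqr] .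
    have "l1 \<subseteq> clo {p, q, r}" using line_subset_cl[OF l(1) i1(2,3)] c ne pqr by auto
    moreover have "l4 \<subseteq> clo {p, q, r}" using line_subset_cl[OF l(4) i4(2,3)] c dist pqr by auto
    ultimately have "y \<in> clo {p, q, r}" "z \<in> clo {p, q, r}" using i1 i4 by auto
    moreover from this have "l2 \<subseteq> clo {p, q, r}" "l5 \<subseteq> clo {p, q, r}"
      using line_subset_cl[OF l(2) i2(1,2)] line_subset_cl[OF l(5) i5(2,3)] c ne dist pqr by auto
    ultimately have "?S \<subseteq> cl N {p, q, r}" using c i2 i5 by auto
    then have "rank N ?S \<le> enat 3"
      using dist by (intro N.rank_le[of "{p, q, r}"]) auto
    moreover have "r \<notin> cl N {p, q}" using line_eq_cl[OF l(1) i1(2,3) ne(4)] a1 by simp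
    then have "3 \<le> rank N ?S" using ne by (intro N.rank_gt2[of p q r]) auto
    ultimately show ?thesis by (simp add: enat_numeral)
  qed
  ultimately show ?thesis
    unfolding HP_def Let_def T_def[symmetric] N_def[symmetric] N(1)
    using dist SE by (auto simp: T'_def split: if_splits)
qed

text \<open>The converse. The intersection of a line with the seven points records at the same time which of
them lie on the line and which do not.\<close>

lemma HP_lines:
  assumes "HP M y x z p q r s"
  shows "distinct [y, x, z, p, q, r, s]" "{y, x, z, p, q, r, s} \<subseteq> E"
    "\<exists>l\<in>lines M. l \<inter> {y, x, z, p, q, r, s} = {y, x, z}"
    "\<exists>l\<in>lines M. l \<inter> {y, x, z, p, q, r, s} = {y, p, q}"
    "\<exists>l\<in>lines M. l \<inter> {y, x, z, p, q, r, s} = {y, r, s}"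
    "\<exists>l\<in>lines M. l \<inter> {y, x, z, p, q, r, s} = {x, q, s}"
    "\<exists>l\<in>lines M. l \<inter> {y, x, z, p, q, r, s} = {z, p, s}"
    "\<exists>l\<in>lines M. l \<inter> {y, x, z, p, q, r, s} = {z, q, r}"
proof -
  let ?S = "{y, x, z, p, q, r, s}"
  let ?T = "{{y, x, z}, {y, p, q}, {y, r, s}, {x, q, s}, {z, p, s}, {z, q, r}}"
  show "distinct [y, x, z, p, q, r, s]" and SE: "?S \<subseteq> E"
    using assms unfolding HP_def by - (elim conjE, assumption)+
  obtain T' where "T' \<in> {?T, insert {x, p, r} ?T}" "three_point_lines (restriction M ?S) = T'"
    using assms unfolding HP_def Let_def by (elim conjE bexE) (rule that)
  then have "?T \<subseteq> three_point_lines (restriction M ?S)" by (elim insertE emptyE) simp_all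
  moreover have "three_point_lines (restriction M ?S) \<subseteq> lines (restriction M ?S)"
    by (auto simp: three_point_lines_def)
  moreover have "\<exists>l\<in>lines M. l \<inter> ?S = t" if "t \<in> lines (restriction M ?S)" for t
    using that unfolding lines_restriction[OF SE] by blast
  ultimately have t: "\<exists>l\<in>lines M. l \<inter> ?S = t" if "t \<in> ?T" for t using that by (meson subset_iff)
  show "\<exists>l\<in>lines M. l \<inter> ?S = {y, x, z}" "\<exists>l\<in>lines M. l \<inter> ?S = {y, p, q}"
    "\<exists>l\<in>lines M. l \<inter> ?S = {y, r, s}" "\<exists>l\<in>lines M. l \<inter> ?S = {x, q, s}"
    "\<exists>l\<in>lines M. l \<inter> ?S = {z, p, s}" "\<exists>l\<in>lines M. l \<inter> ?S = {z, q, r}"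
    by (rule t, simp only: insert_iff simp_thms)+
qed


lemma line_exists:
  assumes "u \<in> E" "v \<in> E" "u \<noteq> v"
  obtains l where "l \<in> lines M" "u \<in> l" "v \<in> l"
  using line_through[OF assms] cl_ext[of "{u, v}"] assms by blast

text \<open>This is the only source of intersection points: the quadrangle \<open>p, q, r, s\<close> forces the lines \<open>yz\<close>
and \<open>pr\<close> to meet. Together with the uniqueness of the conjugate, it turns an incidence that is known
for one quadrangle into an incidence for any other quadrangle over the same triple \<open>y, x, z\<close>.\<close>

lemma harm_conj_meet:
  assumes hp: "HP M y x z p q r s"
    and l: "l \<in> lines M" "y \<in> l" "z \<in> l" and k: "k \<in> lines M" "p \<in> k" "r \<in> k"
  obtains x' where "l \<inter> k = {x'}" "harm_conj M y z x x'"
proof -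
  have "l = clo {y, z}" "k = clo {p, r}"
    using line_eq_cl[OF l] line_eq_cl[OF k] HP_lines(1)[OF hp] by auto
  moreover obtain x' where "clo {y, z} \<inter> clo {p, r} = {x'}"
    using harmonic[unfolded harmonic_matroid_def, THEN conjunct2, THEN conjunct1, rule_format, OF hp]
    by blast
  moreover have "harm_conj M y z x x'" if "clo {y, z} \<inter> clo {p, r} = {x'}" for x'
    unfolding harm_conj_def using hp that
    by (intro exI[of _ p] exI[of _ q] exI[of _ r] exI[of _ s] conjI)
  ultimately show ?thesis using that by metis
qed

lemma harm_conjI:
  assumes "HP M y x z p q r s" "l \<in> lines M" "y \<in> l" "z \<in> l" "k \<in> lines M" "p \<in> k" "r \<in> k"
    and "x' \<in> l" "x' \<in> k"
  shows "harm_conj M y z x x'"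
proof -
  obtain x'' where "l \<inter> k = {x''}" and h: "harm_conj M y z x x''"
    using harm_conj_meet[OF assms(1-7)] .
  moreover have "x' \<in> l \<inter> k" using assms(8,9) by simp
  ultimately have "x' = x''" by (simp only: singleton_iff)
  then show ?thesis using h by simp
qed

lemma harm_conj_unique: "harm_conj M y z x x1 \<Longrightarrow> harm_conj M y z x x2 \<Longrightarrow> x1 = x2"
  using harmonic[unfolded harmonic_matroid_def, THEN conjunct2, THEN conjunct2, rule_format, OF conjI] .

lemma harm_conjD:
  assumes "harm_conj M y z x x'"
  obtains l where "l \<in> lines M" "{y, z, x, x'} \<subseteq> l" "distinct [y, z, x]" "x' \<noteq> y" "x' \<noteq> z"
proof -
  obtain p q r s where hp: "HP M y x z p q r s" and x': "clo {y, z} \<inter> clo {p, r} = {x'}"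
    using assms unfolding harm_conj_def by blast
  note d = HP_lines(1)[OF hp] and SE = HP_lines(2)[OF hp]
  let ?S = "{y, x, z, p, q, r, s}"
  obtain l where l: "l \<in> lines M" "l \<inter> ?S = {y, x, z}" using HP_lines(3)[OF hp] by blast
  obtain l1 where l1: "l1 \<in> lines M" "l1 \<inter> ?S = {y, p, q}" using HP_lines(4)[OF hp] by blast
  obtain l3 where l3: "l3 \<in> lines M" "l3 \<inter> ?S = {z, p, s}" using HP_lines(7)[OF hp] by blast
  have yz: "y \<in> l" "x \<in> l" "z \<in> l" using l by auto
  have "l = clo {y, z}" using line_eq_cl[OF l(1), of y z] yz d by auto
  then have x'l: "x' \<in> l" using x' by auto
  have pr: "p \<in> E" "r \<in> E" "p \<noteq> r" using SE d by auto
  define k where "k = clo {p, r}"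
  have k: "k \<in> lines M" "p \<in> k" "r \<in> k" "x' \<in> k"
    using line_through[OF pr] cl_ext[of "{p, r}"] pr x' unfolding k_def by auto
  have "r \<notin> l1 \<inter> ?S" "r \<notin> l3 \<inter> ?S" unfolding l1(2) l3(2) using d by auto
  then have "r \<notin> l1" "r \<notin> l3" by auto
  have "y \<in> l1" "p \<in> l1" "z \<in> l3" "p \<in> l3" using l1 l3 by auto
  have "x' \<noteq> y" using line_unique[OF k(1) l1(1), of p y] k d \<open>r \<notin> l1\<close> \<open>p \<in> l1\<close> \<open>y \<in> l1\<close> by auto
  moreover have "x' \<noteq> z" using line_unique[OF k(1) l3(1), of p z] k d \<open>r \<notin> l3\<close> \<open>p \<in> l3\<close> \<open>z \<in> l3\<close> by auto
  ultimately show ?thesis using that[OF l(1)] yz x'l d by auto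
qed

definition harm_closed :: "'a set \<Rightarrow> bool" where
  "harm_closed K \<longleftrightarrow> (\<forall>y\<in>K. \<forall>z\<in>K. \<forall>x\<in>K. \<forall>x'. harm_conj M y z x x' \<longrightarrow> x' \<in> K)"

lemma harm_closedD:
  "harm_closed K \<Longrightarrow> harm_conj M y z x x' \<Longrightarrow> y \<in> K \<Longrightarrow> z \<in> K \<Longrightarrow> x \<in> K \<Longrightarrow> x' \<in> K"
  unfolding harm_closed_def by blast

end

section \<open>Coordinates and rows\<close>

text \<open>The frame that a modular sequence generates, in the notation of an affine plane over the integers
modulo \<open>n\<close>. The points \<open>B t\<close> and \<open>C t\<close> stand for \<open>(t, 0)\<close> and \<open>(t, 1)\<close>, the line \<open>LA\<close> for the line at
infinity, \<open>d\<close> for the direction of the horizontal lines (the rows), and \<open>A j\<close> for the direction in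
which the sum of the abscissa and \<open>j\<close> times the ordinate is constant. All points are kept inside a
set \<open>K\<close> closed under conjugation, which will be the harmonic closure of the initial points.\<close>

locale coordinate_frame = harmonic M
  for M :: "'a matroid" +
  fixes K :: "'a set" and n :: int and d :: 'a and A B C :: "int \<Rightarrow> 'a" and LA LB LC :: "'a set"
  assumes n2: "n \<ge> 2"
    and K: "harm_closed K" "d \<in> K" "A i \<in> K" "B i \<in> K" "C i \<in> K"
    and lines3: "LA \<in> lines M" "LB \<in> lines M" "LC \<in> lines M" "LA \<noteq> LB"
    and d: "d \<in> LA" "d \<in> LB" "d \<in> LC"
    and A: "A i \<in> LA" "A i \<noteq> d" and B: "B i \<in> LB" "B i \<noteq> d" and C: "C i \<in> LC"
    and A_eq: "A i = A j \<longleftrightarrow> n dvd (i - j)" and B_eq: "B i = B j \<longleftrightarrow> n dvd (i - j)"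
    and transversal: "\<exists>l\<in>lines M. A i \<in> l \<and> B (i + j) \<in> l \<and> C j \<in> l"
begin

text \<open>The line \<open>m j s\<close> is given by the equation \<open>t + j * u = s\<close> in the coordinates \<open>(t, u)\<close>.\<close>

definition m :: "int \<Rightarrow> int \<Rightarrow> 'a set" where
  "m j s = clo {A j, B s}"

lemma not_dvd_1: "\<not> n dvd 1"
  using n2 by (simp add: zdvd_not_zless)

lemma B_not_LA: "B s \<notin> LA"
  using line_unique[OF lines3(1,2) d(1) _ d(2), of "B s"] B lines3(4) by metis

lemma A_not_LB: "A s \<notin> LB"
  using line_unique[OF lines3(1,2) d(1) _ d(2), of "A s"] A lines3(4) by metis

lemma m: "m j s \<in> lines M" "A j \<in> m j s" "B s \<in> m j s"
proof -
  have *: "A j \<in> E" "B s \<in> E" "A j \<noteq> B s"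
    using A B line_ground[OF lines3(1)] line_ground[OF lines3(2)] A_not_LB[of j] B(1)[of s] by metis+
  show "m j s \<in> lines M" unfolding m_def using line_through[OF *] .
  have "{A j, B s} \<subseteq> clo {A j, B s}" using cl_ext[of "{A j, B s}"] * by blast
  then show "A j \<in> m j s" "B s \<in> m j s" unfolding m_def by auto
qed

lemma m_C: "C k \<in> m j (j + k)"
proof -
  obtain l where l: "l \<in> lines M" "A j \<in> l" "B (j + k) \<in> l" "C k \<in> l" using transversal by blast
  have "A j \<noteq> B (j + k)" using A_not_LB[of j] B(1)[of "j + k"] by metis
  then have "l = m j (j + k)" using line_unique[OF l(1) m(1) l(2,3) m(2,3)] by simp
  then show ?thesis using l by simp
qed

lemma m_cong: "n dvd (s - s') \<Longrightarrow> m j s = m j s'" "n dvd (j - j') \<Longrightarrow> m j s = m j' s"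
  using A_eq[of j j'] B_eq[of s s'] unfolding m_def by auto

lemma m_LA: "P \<in> m j s \<Longrightarrow> P \<in> LA \<Longrightarrow> P = A j"
  using line_unique[OF m(1) lines3(1) m(2) _ A(1)] m(3) B_not_LA by metis

lemma m_LB: "P \<in> m j s \<Longrightarrow> P \<in> LB \<Longrightarrow> P = B s"
  using line_unique[OF m(1) lines3(2) m(3) _ B(1)] m(2) A_not_LB by metis

lemma m_eqD: "m j s = m k s' \<Longrightarrow> n dvd (j - k)" "m j s = m k s' \<Longrightarrow> n dvd (s - s')"
  using m_LA[of "A j" k s'] m_LB[of "B s" k s'] m A B A_eq B_eq by metis+

lemma m_inter:
  assumes "P \<in> m j s" "P \<in> m k s'" "Q \<in> m j s" "Q \<in> m k s'" "\<not> n dvd (j - k)"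
  shows "P = Q"
  using line_unique[OF m(1) m(1) assms(1,3,2,4)] m_eqD(1) assms(5) by blast

text \<open>A point is identified with a coordinate pair when all the lines \<open>m j s\<close> that should pass through it
do so. Nothing is required of the row, since the collinearity of the points of one row with \<open>d\<close> is a
separate and harder fact. Two of the conditions determine the point, so a coordinate pair belongs to at most one point.\<close>

definition coords :: "int \<Rightarrow> int \<Rightarrow> 'a \<Rightarrow> bool" where
  "coords t u P \<longleftrightarrow> (\<forall>j. P \<in> m j (t + j * u))"

lemma coordsD: "coords t u P \<Longrightarrow> s = t + j * u \<Longrightarrow> P \<in> m j s"
  unfolding coords_def by blast

lemma coords_ground: "coords t u P \<Longrightarrow> P \<in> E"
  using line_ground[OF m(1)] unfolding coords_def by blast

lemma coords_cong:
  assumes "coords t u P" "n dvd (t - t')" "n dvd (u - u')"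
  shows "coords t' u' P"
  unfolding coords_def
proof
  fix j
  have "t + j * u - (t' + j * u') = (t - t') + j * (u - u')" by (simp add: algebra_simps)
  moreover have "n dvd (t - t') + j * (u - u')" using assms(2,3) by (intro dvd_add dvd_mult)
  ultimately have "n dvd (t + j * u - (t' + j * u'))" by (simp only:)
  then show "P \<in> m j (t' + j * u')" using assms(1) m_cong(1) unfolding coords_def by blast
qed

lemma coords_not_LA: "coords t u P \<Longrightarrow> P \<notin> LA"
  using m_LA[of P 0 t] m_LA[of P 1 "t + u"] coordsD[of t u P t 0] coordsD[of t u P "t + u" 1]
    A_eq[of 1 0] not_dvd_1 by auto

lemma coords_m: "coords t u P \<Longrightarrow> P \<in> m j s \<Longrightarrow> n dvd (t + j * u - s)"
proof -
  assume P: "coords t u P" "P \<in> m j s"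
  then have "P \<noteq> A j" using coords_not_LA A by blast
  then have "m j (t + j * u) = m j s"
    using line_unique[OF m(1) m(1) coordsD[OF P(1) refl] m(2) P(2) m(2)] by blast
  then show ?thesis by (rule m_eqD(2))
qed

lemma coords_inj:
  assumes "coords t u P" "coords t' u' P"
  shows "n dvd (t - t')" "n dvd (u - u')"
proof -
  show t: "n dvd (t - t')" using coords_m[OF assms(1) coordsD[OF assms(2), of t' 0]] by simp
  have "n dvd (t + u - (t' + u'))" using coords_m[OF assms(1) coordsD[OF assms(2), of "t' + u'" 1]] by simp
  then have "n dvd (t + u - (t' + u') - (t - t'))" using t by (rule dvd_diff)
  then show "n dvd (u - u')" by (simp add: algebra_simps)
qed

lemma coords_unique: "coords t u P \<Longrightarrow> coords t u Q \<Longrightarrow> P = Q"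
  using m_inter[of P 0 t 1 "t + u" Q] not_dvd_1 coordsD[of t u _ t 0] coordsD[of t u _ "t + u" 1]
  by auto

definition row :: "int \<Rightarrow> bool" where
  "row u \<longleftrightarrow> (\<forall>t. \<exists>P\<in>K. coords t u P)"

definition row_line :: "int \<Rightarrow> 'a set \<Rightarrow> bool" where
  "row_line u l \<longleftrightarrow> l \<in> lines M \<and> d \<in> l \<and> (\<forall>t P. coords t u P \<longrightarrow> P \<in> l)"

lemma rowE:
  assumes "row u"
  obtains P where "P \<in> K" "coords t u P"
  using assms unfolding row_def by blast

lemma coords_B: "coords t 0 (B t)"
  using m unfolding coords_def by simp

lemma coords_C: "coords t 1 (C t)"
  using m_C[of t] unfolding coords_def by (simp add: add.commute)

lemma row_0: "row 0" and row_1: "row 1"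
  unfolding row_def using coords_B coords_C K by blast+

lemma row_line_0: "row_line 0 LB" and row_line_1: "row_line 1 LC"
  unfolding row_line_def using coords_B coords_C coords_unique lines3 d B C by metis+

text \<open>Given a row \<open>u\<close> and a row \<open>u - e\<close>, both collinear with \<open>d\<close>, the point \<open>(t, u + e)\<close> is the harmonic conjugate
of \<open>(t, u - e)\<close> with respect to \<open>A 0\<close> and \<open>(t, u)\<close>. For each direction \<open>A j\<close> other than \<open>A 0\<close>, the
quadrangle of \<open>A j\<close>, \<open>d\<close>, \<open>(t + e j, u)\<close> and \<open>(t + e j, u - e)\<close> shows that the conjugate lies on the line in
direction \<open>A j\<close> that should contain it.\<close>

lemma row_step:
  assumes l: "row_line u l" "row_line (u - e) l'"
    and c: "coords t u Z" "coords t (u - e) X" "coords (t + e * j) u R" "coords (t + e * j) (u - e) S"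
    and nd: "\<not> n dvd j" "\<not> n dvd e"
  obtains P where "harm_conj M (A 0) Z X P" "P \<in> m 0 t" "P \<in> m j (t + j * (u + e))"
proof -
  note ll = l[unfolded row_line_def]
  have "A 0 \<noteq> A j" using A_eq[of j 0] nd by auto
  moreover have "R \<noteq> S"
  proof
    assume "R = S"
    then have "n dvd (u - (u - e))" using coords_inj(2) c(3,4) by blast
    then show False using nd(2) by simp
  qed
  moreover have "LA \<noteq> m 0 (t + e * j)" using B_not_LA m by blast
  moreover have "A 0 \<noteq> R" "A 0 \<noteq> S" using coords_not_LA A(1)[of 0] c by metis+
  ultimately have "HP M (A 0) X Z (A j) d R S"
    using A d ll c
    by (intro HP_I[of LA "m 0 (t + e * j)" "m j (t + j * u)" l "m 0 t" l'])
      (auto intro: m lines3 coordsD simp: algebra_simps)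
  then obtain P where "m 0 t \<inter> m j (t + j * (u + e)) = {P}" "harm_conj M (A 0) Z X P"
    by (rule harm_conj_meet[of _ _ _ _ _ _ _ "m 0 t" "m j (t + j * (u + e))"])
      (auto intro: m coordsD[OF c(1)] coordsD[OF c(3)] simp: algebra_simps)
  then show ?thesis using that by blast
qed

text \<open>The conjugate in \<open>row_step\<close> does not depend on the quadrangle, hence not on \<open>j\<close>. So one and the same
point lies on the lines in all directions at once. The increment \<open>e\<close> is kept general because both
the row above and the row below are needed.\<close>

lemma row_next:
  assumes r: "row u" "row (u - e)" and l: "row_line u l" "row_line (u - e) l'" and e: "\<not> n dvd e"
  shows "row (u + e)"
  unfolding row_def
proof
  fix t
  obtain Z X where Z: "Z \<in> K" "coords t u Z" and X: "X \<in> K" "coords t (u - e) X"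
    using rowE[OF r(1)] rowE[OF r(2)] by metis
  have step: "\<exists>P. harm_conj M (A 0) Z X P \<and> P \<in> m 0 t \<and> P \<in> m j (t + j * (u + e))"
    if "\<not> n dvd j" for j
  proof -
    obtain R where "coords (t + e * j) u R" using rowE[OF r(1)] .
    moreover obtain S where "coords (t + e * j) (u - e) S" using rowE[OF r(2)] .
    ultimately show ?thesis using row_step[OF l Z(2) X(2) _ _ that e] by metis
  qed
  obtain P where P: "harm_conj M (A 0) Z X P" "P \<in> m 0 t" using step[OF not_dvd_1] by blast
  have "P \<in> m j (t + j * (u + e))" for j
  proof (cases "n dvd j")
    case True
    then have "n dvd (j - 0)" "n dvd (t + j * (u + e) - t)" by auto
    then have "m j (t + j * (u + e)) = m 0 t" using m_cong by metis
    then show ?thesis using P by simp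
  next
    case False
    then show ?thesis using step harm_conj_unique[OF P(1)] by blast
  qed
  moreover have "P \<in> K" using harm_closedD[OF K(1) P(1)] K Z X by blast
  ultimately show "\<exists>P\<in>K. coords t (u + e) P" unfolding coords_def by blast
qed

text \<open>The midpoint property within a row: \<open>(i, v)\<close> and \<open>(i + 2k, v)\<close> are separated harmonically by
\<open>(i + k, v)\<close> and the point at infinity \<open>d\<close>. The quadrangle consists of the directions \<open>A k\<close> and
\<open>A (- k)\<close> and the points above and below the midpoint; the two directions differ only if \<open>2k\<close> is
nonzero modulo \<open>n\<close>.\<close>

lemma conj_d:
  assumes r: "row (v + 1)" "row (v - 1)" and l: "row_line v l"
    and c: "coords i v Y" "coords (i + 2 * k) v Z" "coords (i + k) v X" and nd: "\<not> n dvd 2 * k"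
  shows "harm_conj M Y Z X d"
proof -
  note ll = l[unfolded row_line_def]
  obtain Q where Q: "coords (i + k) (v + 1) Q" using rowE[OF r(1)] .
  obtain S where S: "coords (i + k) (v - 1) S" using rowE[OF r(2)] .
  have "m (- k) (i - k * v) \<noteq> m k (i + k * v)"
    using m_eqD(1)[of k "i + k * v" "- k" "i - k * v"] nd by auto
  moreover have "Y \<noteq> A (- k)" "Y \<noteq> A k" "A (- k) \<noteq> Q" "A k \<noteq> S"
    using coords_not_LA A(1) c Q S by metis+
  moreover have "Y \<noteq> Q" using coords_inj(2)[OF Q, of i v] c(1) not_dvd_1 by auto
  moreover have "Y \<noteq> S" using coords_inj(2)[OF c(1), of "i + k" "v - 1"] S not_dvd_1 by auto
  ultimately have "HP M Y X Z (A (- k)) Q (A k) S"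
    using c Q S ll
    by (intro HP_I[of "m (- k) (i - k * v)" "m k (i + k * v)" "m (- k) (i + 2 * k - k * v)"
          "m k (i + 2 * k + k * v)" l "m 0 (i + k)"])
      (auto intro: m coordsD simp: algebra_simps)
  then show ?thesis
    by (rule harm_conjI[of _ _ _ _ _ _ _ l LA]) (use ll c lines3 A d in auto)
qed

text \<open>The same triple in row \<open>v\<close> has a second quadrangle: \<open>(i, v + 2)\<close>, \<open>A 0\<close>, \<open>(i + 2k, v + 2)\<close> and
\<open>(i + k, v + 1)\<close>. Since the conjugate is \<open>d\<close> by \<open>conj_d\<close>, the line through the two points of row \<open>v + 2\<close>
passes through \<open>d\<close>.\<close>

lemma collinear_d:
  assumes r: "row (v + 1)" "row (v - 1)" "row v" and l: "row_line v l" and n: "\<not> n dvd 2"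
    and c: "coords i (v + 2) P" "coords (i + 2 * k) (v + 2) R" and nd: "\<not> n dvd 2 * k"
    and g: "g \<in> lines M" "P \<in> g" "R \<in> g"
  shows "d \<in> g"
proof -
  note ll = l[unfolded row_line_def]
  obtain Y where Y: "coords i v Y" using rowE[OF r(3)] .
  obtain X where X: "coords (i + k) v X" using rowE[OF r(3)] .
  obtain Z where Z: "coords (i + 2 * k) v Z" using rowE[OF r(3)] .
  obtain S where S: "coords (i + k) (v + 1) S" using rowE[OF r(1)] .
  have k: "\<not> n dvd k" using nd by auto
  have "m 0 i \<noteq> m (- k) (i - k * v)"
    using m_eqD(1)[of 0 i "- k" "i - k * v"] k by auto
  moreover have "Y \<noteq> A 0" "P \<noteq> A 0" using coords_not_LA A(1) c Y by metis+
  moreover have "Y \<noteq> P" using coords_inj(2)[OF c(1), of i v] Y n by auto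
  moreover have "Y \<noteq> R" using coords_inj(2)[OF c(2), of i v] Y n by auto
  moreover have "Y \<noteq> S" using coords_inj(2)[OF S, of i v] Y not_dvd_1 by auto
  moreover have "R \<noteq> S" using coords_inj(2)[OF c(2), of "i + k" "v + 1"] S not_dvd_1 by auto
  ultimately have "HP M Y X Z P (A 0) R S"
    using c Y X Z S ll
    by (intro HP_I[of "m 0 i" "m (- k) (i - k * v)" "m k (i + 2 * k + k * v)"
          "m 0 (i + 2 * k)" l "m 0 (i + k)"])
      (auto intro: m coordsD simp: algebra_simps)
  then obtain x' where x': "l \<inter> g = {x'}" "harm_conj M Y Z X x'"
    by (rule harm_conj_meet[of _ _ _ _ _ _ _ l g]) (use ll g Y Z in auto)
  have "harm_conj M Y Z X d" using conj_d[OF r(1,2) l Y Z X nd] .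
  then have "x' = d" using harm_conj_unique x'(2) by blast
  then show ?thesis using x'(1) by blast
qed

text \<open>For odd \<open>n\<close> every residue is of the form \<open>2k\<close>, so \<open>collinear_d\<close> applies to the point with abscissa \<open>0\<close>
and any other point of the row.\<close>

lemma row_line_next:
  assumes r: "row (v + 1)" "row (v - 1)" "row v" "row (v + 2)" and l: "row_line v l" and n: "odd n"
  obtains g where "row_line (v + 2) g"
proof -
  have n2': "\<not> n dvd 2" using n n2 zdvd_imp_le[of n 2] by auto
  obtain P where P: "coords 0 (v + 2) P" using rowE[OF r(4)] .
  obtain R where R: "coords (0 + 2 * 1) (v + 2) R" using rowE[OF r(4)] .
  have "P \<noteq> R" using coords_inj(1)[of 2 "v + 2" R 0] P R n2' by auto
  then obtain g where g: "g \<in> lines M" "P \<in> g" "R \<in> g"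
    using line_exists[OF coords_ground[OF P] coords_ground[OF R]] by blast
  have dg: "d \<in> g" using collinear_d[OF r(1-3) l n2' P R _ g] n2' by simp
  have "Q \<in> g" if Q: "coords t (v + 2) Q" for t Q
  proof (cases "n dvd t")
    case True
    then have "coords 0 (v + 2) Q" using coords_cong[OF Q] by simp
    then show ?thesis using coords_unique[OF P] g by blast
  next
    case False
    \<comment> \<open>\<open>(n + 1) div 2\<close> is the inverse of \<open>2\<close> modulo \<open>n\<close>, so \<open>2 * k\<close> is \<open>t\<close>.\<close>
    define k where "k = t * ((n + 1) div 2)"
    have "2 * ((n + 1) div 2) = n + 1" using n by presburger
    then have k: "2 * k = t * n + t" unfolding k_def by (simp add: algebra_simps)
    have Q': "coords (0 + 2 * k) (v + 2) Q" using coords_cong[OF Q] k by simp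
    have "P \<noteq> Q" using coords_inj(1)[OF Q, of 0 "v + 2"] P False by auto
    then obtain h where h: "h \<in> lines M" "P \<in> h" "Q \<in> h"
      using line_exists[OF coords_ground[OF P] coords_ground[OF Q]] by blast
    have "\<not> n dvd 2 * k" using k False by simp
    then have "d \<in> h" using collinear_d[OF r(1-3) l n2' P Q' _ h] by blast
    moreover have "P \<noteq> d" using coords_not_LA[OF P] d by blast
    ultimately have "g = h" using line_unique[OF g(1) h(1) g(2) dg h(2)] by blast
    then show ?thesis using h by simp
  qed
  then show ?thesis using that g dg unfolding row_line_def by blast
qed

lemma rows_odd:
  assumes "odd n"
  shows "row (int v - 1) \<and> row (int v) \<and> row (int v + 1) \<and> (\<exists>l. row_line (int v) l) \<and> (\<exists>l. row_line (int v + 1) l)"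
proof (induction v)
  case 0
  \<comment> \<open>Row \<open>-1\<close> is the reflection of row \<open>2\<close>: it is obtained from rows \<open>1\<close> and \<open>0\<close> with increment \<open>-1\<close>.\<close>
  have "\<not> n dvd - 1" using not_dvd_1 by simp
  then have "row (0 + - 1)" by (intro row_next[of 0 "- 1" LB LC]) (simp_all add: row_0 row_1 row_line_0 row_line_1)
  then show ?case using row_0 row_1 row_line_0 row_line_1 by auto
next
  case (Suc v)
  then obtain l l' where h: "row (int v - 1)" "row (int v)" "row (int v + 1)"
    "row_line (int v) l" "row_line (int v + 1) l'" by blast
  have "row (int v + 1 + 1)" using h not_dvd_1 by (intro row_next[of "int v + 1" 1 l' l]) simp_all
  then have r: "row (int v + 2)" by (simp add: add.assoc)
  obtain g where "row_line (int v + 2) g" using row_line_next[OF h(3,1,2) r h(4) assms] .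
  then show ?case using h r by (auto simp: add.assoc add.commute)
qed

text \<open>If \<open>n = u * k\<close>, then the point \<open>(0, u)\<close> lies on \<open>m 0 0\<close> and on \<open>m k (k * u) = m k 0\<close>, which meet in \<open>(0, 0)\<close>.
By the uniqueness of coordinates \<open>u\<close> is then zero modulo \<open>n\<close>.\<close>

lemma no_factor:
  assumes r: "row u" and n: "n = u * k" and k: "\<not> n dvd k" and u: "\<not> n dvd u"
  shows False
proof -
  obtain P where P: "coords 0 u P" using rowE[OF r] .
  have "P \<in> m k (k * u)" "P \<in> m 0 0" using coordsD[OF P, of _ k] coordsD[OF P, of _ 0] by auto
  moreover have "B 0 \<in> m k (k * u)" using m(3)[of 0 k] m_cong(1)[of "k * u" 0 k] n by (simp add: mult.commute)
  ultimately have "P = B 0" using m_inter[of P k "k * u" 0 0 "B 0"] m(3) k by simp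
  then have "n dvd (u - 0)" using coords_inj(2)[OF P] coords_B by blast
  then show False using u by simp
qed

lemma row_2: "row 2"
  using row_next[of 1 1 LC LB] row_0 row_1 row_line_0 row_line_1 not_dvd_1 by simp

text \<open>Row \<open>2\<close> is available for every \<open>n\<close> because rows \<open>0\<close> and \<open>1\<close> are collinear with \<open>d\<close> by assumption. It
already excludes even \<open>n\<close> other than \<open>2\<close>, which leaves only odd \<open>n\<close> for the construction of the higher rows.\<close>

lemma even_imp_2:
  assumes "even n"
  shows "n = 2"
proof (rule ccontr)
  assume "n \<noteq> 2"
  then have "n > 2" using n2 by simp
  obtain k where k: "n = 2 * k" using assms by blast
  show False using no_factor[OF row_2 k] zdvd_not_zless[of _ n] \<open>n > 2\<close> k by simp
qed

lemma n_prime: "prime n"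
proof (cases "even n")
  case True
  then show ?thesis using even_imp_2 by simp
next
  case False
  show ?thesis
  proof (rule ccontr)
    assume "\<not> prime n"
    then obtain u where u: "u \<ge> 0" "u dvd n" "u \<noteq> 1" "u \<noteq> n"
      using n2 unfolding prime_int_iff by auto
    obtain k where k: "n = u * k" using u(2) by blast
    have u2: "u \<ge> 2" using u(1,3) n2 k by (cases "u = 0") auto
    have "u < n" using zdvd_imp_le[OF u(2)] u(4) n2 by simp
    then have nu: "\<not> n dvd u" using zdvd_not_zless[of u n] u2 by simp
    have "k > 0"
    proof (rule ccontr)
      assume "\<not> k > 0"
      then have "u * k \<le> 0" using u(1) by (intro mult_nonneg_nonpos) auto
      then show False using k n2 by simp
    qed
    then have "1 * k < u * k" using u2 by (intro mult_strict_right_mono) auto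
    then have "\<not> n dvd k" using zdvd_not_zless[of k n] \<open>k > 0\<close> k by simp
    moreover have "row u" using rows_odd[OF False, of "nat u"] u2 by simp
    ultimately show False using no_factor[OF _ k _ nu] by blast
  qed
qed

lemma all_rows: "row u" and all_row_lines: "\<exists>l. row_line u l"
proof -
  let ?v = "u mod n"
  have v: "0 \<le> ?v" "?v < n" using n2 by auto
  have *: "row ?v \<and> (\<exists>l. row_line ?v l)"
  proof (cases "even n")
    case True
    then have "?v = 0 \<or> ?v = 1" using v even_imp_2 by auto
    then show ?thesis using row_0 row_1 row_line_0 row_line_1 by metis
  next
    case False
    then show ?thesis using rows_odd[of "nat ?v"] v by auto
  qed
  have dv: "n dvd (?v - u)" "n dvd (u - ?v)" by (simp_all add: mod_eq_dvd_iff[symmetric])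
  have "coords t ?v P \<longleftrightarrow> coords t u P" for t P
    using coords_cong[of t ?v P t u] coords_cong[of t u P t ?v] dv by auto
  then show "row u" "\<exists>l. row_line u l" using * unfolding row_def row_line_def by auto
qed

section \<open>Incidences modulo a prime\<close>

definition G :: "int \<Rightarrow> int \<Rightarrow> 'a" where
  "G t u = (SOME P. P \<in> K \<and> coords t u P)"

definition R :: "int \<Rightarrow> 'a set" where
  "R u = (SOME l. row_line u l)"

lemma G: "G t u \<in> K" "coords t u (G t u)"
proof -
  obtain P where "P \<in> K \<and> coords t u P" using rowE[OF all_rows] by metis
  then have "G t u \<in> K \<and> coords t u (G t u)" unfolding G_def by (rule someI)
  then show "G t u \<in> K" "coords t u (G t u)" by auto
qed

lemma R: "R u \<in> lines M" "d \<in> R u" "G t u \<in> R u"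
proof -
  have "row_line u (R u)" unfolding R_def using all_row_lines by (rule someI_ex)
  then show "R u \<in> lines M" "d \<in> R u" "G t u \<in> R u" unfolding row_line_def using G(2) by auto
qed

lemma G_eq: "G t u = G t' u' \<longleftrightarrow> n dvd (t - t') \<and> n dvd (u - u')"
proof
  assume "G t u = G t' u'"
  then show "n dvd (t - t') \<and> n dvd (u - u')"
    using coords_inj[OF G(2)[of t u], of t' u'] G(2)[of t' u'] by simp
next
  assume "n dvd (t - t') \<and> n dvd (u - u')"
  then show "G t u = G t' u'"
    using coords_cong[OF G(2)[of t u], of t' u'] coords_unique[OF _ G(2)[of t' u']] by blast
qed

lemma G_m: "G t u \<in> m j s \<longleftrightarrow> n dvd (t + j * u - s)"
proof
  show "G t u \<in> m j s \<Longrightarrow> n dvd (t + j * u - s)" using coords_m G(2) by blast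
  assume "n dvd (t + j * u - s)"
  then have "m j (t + j * u) = m j s" by (rule m_cong)
  then show "G t u \<in> m j s" using coordsD[OF G(2)[of t u] refl, of j] by simp
qed

lemma G_not_LA: "G t u \<notin> LA"
  using coords_not_LA G(2) by blast

lemma d_not_m: "d \<notin> m j s"
  using m_LA[of d j s] d A(2)[of j] by metis

lemma G_R: "G t u \<in> R v \<longleftrightarrow> n dvd (u - v)"
proof
  assume g: "G t u \<in> R v"
  show "n dvd (u - v)"
  proof (rule ccontr)
    assume nd: "\<not> n dvd (u - v)"
    then have "G t u \<noteq> G t v" using G_eq by simp
    moreover have "G t u \<in> m 0 t" "G t v \<in> m 0 t" by (simp_all add: G_m)
    ultimately have "R v = m 0 t" using line_unique[OF R(1) m(1) g R(3)] by blast
    then show False using R(2) d_not_m by metis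
  qed
next
  assume "n dvd (u - v)"
  then have "G t u = G t v" using G_eq by simp
  then show "G t u \<in> R v" using R(3) by simp
qed

lemma A_not_R: "A i \<notin> R u"
  using line_unique[OF R(1) lines3(1) R(2) _ d(1), of "A i" u] A G_not_LA R(3) by metis

text \<open>The points and lines of the projective plane over the integers modulo \<open>n\<close>. Incidence has become
a matter of congruences, and since \<open>n\<close> is prime the linear congruences that express joining and
meeting are solvable.\<close>

definition points :: "'a set" where
  "points = insert d (range A \<union> {G t u | t u. True})"

definition plane_lines :: "'a set set" where
  "plane_lines = insert LA (range R \<union> {m j s | j s. True})"

lemma points_cases:
  assumes "P \<in> points"
  obtains "P = d" | i where "P = A i" | t u where "P = G t u"
  using assms unfolding points_def by blast

lemma pointsI: "d \<in> points" "A i \<in> points" "G t u \<in> points"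
  unfolding points_def by auto

lemma plane_lines_cases:
  assumes "l \<in> plane_lines"
  obtains "l = LA" | u where "l = R u" | j s where "l = m j s"
  using assms unfolding plane_lines_def by blast

lemma plane_linesI: "LA \<in> plane_lines" "R u \<in> plane_lines" "m j s \<in> plane_lines"
  unfolding plane_lines_def by auto

lemma solve_mod:
  assumes "\<not> n dvd a"
  obtains x where "n dvd (a * x - b)"
proof -
  have "gcd n a = 1" using prime_imp_coprime[OF n_prime assms] by simp
  then obtain u v where "u * n + v * a = 1" using bezout_int[of n a] by auto
  then have "b = b * (u * n + v * a)" by simp
  then have "a * (v * b) - b = n * (- u * b)" by (simp add: algebra_simps)
  then show ?thesis using that[of "v * b"] by simp
qed

lemma join:
  assumes "P \<in> points" "Q \<in> points"
  shows "\<exists>l\<in>plane_lines. P \<in> l \<and> Q \<in> l"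
proof -
  have AG: "\<exists>l\<in>plane_lines. A i \<in> l \<and> G t u \<in> l" for i t u
    using plane_linesI(3)[of i "t + i * u"] m(2) G_m[of t u i "t + i * u"] by auto
  have dG: "\<exists>l\<in>plane_lines. d \<in> l \<and> G t u \<in> l" for t u
    using plane_linesI(2)[of u] R(2)[of u] R(3)[of t u] by blast
  have LA: "\<exists>l\<in>plane_lines. x \<in> l \<and> y \<in> l" if "x \<in> LA" "y \<in> LA" for x y
    using plane_linesI(1) that by blast
  have GG: "\<exists>l\<in>plane_lines. G t u \<in> l \<and> G t' u' \<in> l" for t u t' u'
  proof (cases "n dvd (u - u')")
    case True
    then have "G t u \<in> R u'" using G_R by simp
    then show ?thesis using plane_linesI(2)[of u'] R(3)[of t' u'] by blast
  next
    case False
    obtain j where j: "n dvd ((u - u') * j - (t' - t))" using solve_mod[OF False] .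
    have e: "(u - u') * j - (t' - t) = t + j * u - (t' + j * u')" by (simp add: algebra_simps)
    have "G t u \<in> m j (t' + j * u')" using j unfolding G_m e .
    moreover have "G t' u' \<in> m j (t' + j * u')" by (simp add: G_m)
    ultimately show ?thesis using plane_linesI(3)[of j "t' + j * u'"] by blast
  qed
  show ?thesis
    using assms(1)
  proof (cases rule: points_cases)
    case P: 1
    show ?thesis using assms(2)
    proof (cases rule: points_cases)
      case 1 show ?thesis unfolding P 1 using LA[OF d(1) d(1)] .
    next
      case (2 i) show ?thesis unfolding P 2 using LA[OF d(1) A(1)] .
    next
      case (3 t u) show ?thesis unfolding P 3 using dG .
    qed
  next
    case P: (2 i)
    show ?thesis using assms(2)
    proof (cases rule: points_cases)
      case 1 show ?thesis unfolding P 1 using LA[OF A(1) d(1)] .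
    next
      case (2 j) show ?thesis unfolding P 2 using LA[OF A(1) A(1)] .
    next
      case (3 t u) show ?thesis unfolding P 3 using AG .
    qed
  next
    case P: (3 t u)
    show ?thesis using assms(2)
    proof (cases rule: points_cases)
      case 1 show ?thesis unfolding P 1 using dG[of t u] by (simp only: conj_commute)
    next
      case (2 i) show ?thesis unfolding P 2 using AG[of i t u] by (simp only: conj_commute)
    next
      case (3 t' u') show ?thesis unfolding P 3 using GG .
    qed
  qed
qed

lemma meet:
  assumes "l \<in> plane_lines" "k \<in> plane_lines" "l \<noteq> k"
  shows "\<exists>P\<in>points. P \<in> l \<and> P \<in> k"
proof -
  have Lm: "\<exists>P\<in>points. P \<in> LA \<and> P \<in> m j s" for j s
    using pointsI(2)[of j] A(1)[of j] m(2)[of j s] by blast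
  have Rm: "\<exists>P\<in>points. P \<in> R u \<and> P \<in> m j s" for u j s
    using pointsI(3)[of "s - j * u" u] R(3) G_m[of "s - j * u" u j s] by auto
  have dd: "\<exists>P\<in>points. P \<in> x \<and> P \<in> y" if "d \<in> x" "d \<in> y" for x y
    using pointsI(1) that by blast
  have mm: "\<exists>P\<in>points. P \<in> m j s \<and> P \<in> m j' s'" for j s j' s'
  proof (cases "n dvd (j - j')")
    case True
    then have "A j \<in> m j' s'" using A_eq m(2) by metis
    then show ?thesis using m(2)[of j s] pointsI(2)[of j] by blast
  next
    case False
    obtain u where u: "n dvd ((j - j') * u - (s - s'))" using solve_mod[OF False] .
    have e: "(j - j') * u - (s - s') = - (s - j * u + j' * u - s')" by (simp add: algebra_simps)
    have "n dvd (s - j * u + j' * u - s')" using u unfolding e by (simp only: dvd_minus_iff)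
    then have "G (s - j * u) u \<in> m j' s'" by (simp add: G_m)
    moreover have "G (s - j * u) u \<in> m j s" by (simp add: G_m)
    ultimately show ?thesis using pointsI(3)[of "s - j * u" u] by blast
  qed
  show ?thesis
    using assms(1)
  proof (cases rule: plane_lines_cases)
    case l: 1
    show ?thesis using assms(2)
    proof (cases rule: plane_lines_cases)
      case 1 then show ?thesis using assms(3) l by simp
    next
      case (2 u) show ?thesis unfolding l 2 using dd[OF d(1) R(2)] .
    next
      case (3 j s) show ?thesis unfolding l 3 using Lm .
    qed
  next
    case l: (2 u)
    show ?thesis using assms(2)
    proof (cases rule: plane_lines_cases)
      case 1 show ?thesis unfolding l 1 using dd[OF R(2) d(1)] .
    next
      case (2 v) show ?thesis unfolding l 2 using dd[OF R(2) R(2)] .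
    next
      case (3 j s) show ?thesis unfolding l 3 using Rm .
    qed
  next
    case l: (3 j s)
    show ?thesis using assms(2)
    proof (cases rule: plane_lines_cases)
      case 1 show ?thesis unfolding l 1 using Lm[of j s] by (simp only: conj_commute)
    next
      case (2 u) show ?thesis unfolding l 2 using Rm[of u j s] by (simp only: conj_commute)
    next
      case (3 j' s') show ?thesis unfolding l 3 using mm .
    qed
  qed
qed

lemma mod_diff: "n dvd (i - i mod n)" "n dvd (i mod n - i)"
  by (simp_all add: mod_eq_dvd_iff[symmetric])

lemma card_parametrized:
  assumes "\<And>i j. f i = f j \<Longrightarrow> n dvd (i - j)" and "x \<notin> range f"
    and "X = insert x (f ` {0..<n})"
  shows "finite X \<and> card X = nat n + 1"
proof -
  have "inj_on f {0..<n}"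
  proof (rule inj_onI)
    fix i j assume ij: "i \<in> {0..<n}" "j \<in> {0..<n}" "f i = f j"
    then have "n dvd (i - j)" using assms(1) by blast
    then have "i mod n = j mod n" by (simp add: mod_eq_dvd_iff)
    then show "i = j" using ij by simp
  qed
  then have "card (f ` {0..<n}) = nat n" by (simp add: card_image)
  moreover have "x \<notin> f ` {0..<n}" using assms(2) by blast
  ultimately show ?thesis using assms(3) by simp
qed

lemma mod_range: "i mod n \<in> {0..<n}"
  using n2 by simp

lemma line_card:
  assumes "l \<in> plane_lines"
  shows "finite (l \<inter> points) \<and> card (l \<inter> points) = nat n + 1"
  using assms
proof (cases rule: plane_lines_cases)
  case 1
  have "l \<inter> points = insert d (A ` {0..<n})"
  proof (intro subset_antisym subsetI)
    fix P assume "P \<in> l \<inter> points"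
    then have P: "P \<in> points" "P \<in> LA" using 1 by auto
    then show "P \<in> insert d (A ` {0..<n})"
    proof (cases rule: points_cases)
      case (2 i)
      then have "P = A (i mod n)" using A_eq mod_diff by simp
      then show ?thesis using mod_range by blast
    qed (use P G_not_LA in auto)
  next
    fix P assume "P \<in> insert d (A ` {0..<n})"
    then show "P \<in> l \<inter> points" using 1 d A pointsI by auto
  qed
  moreover have "d \<notin> range A" using A(2) by auto
  ultimately show ?thesis using A_eq by (intro card_parametrized[of A d]) auto
next
  case (2 u)
  have "l \<inter> points = insert d ((\<lambda>t. G t u) ` {0..<n})"
  proof (intro subset_antisym subsetI)
    fix P assume "P \<in> l \<inter> points"
    then have P: "P \<in> points" "P \<in> R u" using 2 by auto
    then show "P \<in> insert d ((\<lambda>t. G t u) ` {0..<n})"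
    proof (cases rule: points_cases)
      case (3 t v)
      then have "P = G (t mod n) u" using P G_R G_eq mod_diff by simp
      then show ?thesis using mod_range by blast
    qed (use P A_not_R in auto)
  next
    fix P assume "P \<in> insert d ((\<lambda>t. G t u) ` {0..<n})"
    then show "P \<in> l \<inter> points" using 2 R pointsI by auto
  qed
  moreover have "d \<notin> range (\<lambda>t. G t u)" using G_not_LA d(1) by (metis rangeE)
  ultimately show ?thesis using G_eq by (intro card_parametrized[of "\<lambda>t. G t u" d]) auto
next
  case (3 j s)
  have "l \<inter> points = insert (A j) ((\<lambda>u. G (s - j * u) u) ` {0..<n})"
  proof (intro subset_antisym subsetI)
    fix P assume "P \<in> l \<inter> points"
    then have P: "P \<in> points" "P \<in> m j s" using 3 by auto
    then show "P \<in> insert (A j) ((\<lambda>u. G (s - j * u) u) ` {0..<n})"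
    proof (cases rule: points_cases)
      case (2 i)
      then show ?thesis using m_LA P A by blast
    next
      case (3 t u)
      have "t - (s - j * (u mod n)) = (t + j * u - s) - j * (u - u mod n)"
        by (simp add: algebra_simps)
      then have "n dvd (t - (s - j * (u mod n)))"
        using 3 P G_m mod_diff(1)[of u] by (metis dvd_diff dvd_mult)
      then have "P = G (s - j * (u mod n)) (u mod n)" using 3 G_eq mod_diff by simp
      then show ?thesis using mod_range by blast
    qed (use P d_not_m in auto)
  next
    fix P assume "P \<in> insert (A j) ((\<lambda>u. G (s - j * u) u) ` {0..<n})"
    then show "P \<in> l \<inter> points" using 3 m(2) G_m pointsI by auto
  qed
  moreover have "A j \<noteq> G t u" for t u using G_not_LA[of t u] A(1)[of j] by metis
  then have "A j \<notin> range (\<lambda>u. G (s - j * u) u)" by blast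
  ultimately show ?thesis using G_eq by (intro card_parametrized[of "\<lambda>u. G (s - j * u) u" "A j"]) auto
qed

end

section \<open>Projective planes\<close>

context harmonic
begin

text \<open>It suffices to know a set \<open>\<Lambda>\<close> of lines that joins all pairs of points: every other line of \<open>M\<close> has at
most one point in \<open>S\<close>, so \<open>\<Lambda>\<close> yields all lines of the restriction.\<close>

lemma projective_planeI:
  assumes S: "S \<subseteq> E" and L: "\<Lambda> \<subseteq> lines M"
    and join: "\<And>P Q. P \<in> S \<Longrightarrow> Q \<in> S \<Longrightarrow> \<exists>l\<in>\<Lambda>. P \<in> l \<and> Q \<in> l"
    and meet: "\<And>l k. l \<in> \<Lambda> \<Longrightarrow> k \<in> \<Lambda> \<Longrightarrow> l \<noteq> k \<Longrightarrow> \<exists>P\<in>S. P \<in> l \<and> P \<in> k"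
    and card: "\<And>l. l \<in> \<Lambda> \<Longrightarrow> finite (l \<inter> S) \<and> card (l \<inter> S) = N + 1"
    and Q: "Q \<subseteq> S" "card Q = 4" "\<And>l. l \<in> lines M \<Longrightarrow> card (Q \<inter> l) \<le> 2"
    and N: "N \<ge> 1"
  shows "is_projective_plane_of_order M S N"
proof -
  let ?L = "(\<lambda>l. l \<inter> S) ` \<Lambda>"
  have lines: "lines (restriction M S) = ?L"
  proof (intro subset_antisym subsetI)
    fix K assume "K \<in> lines (restriction M S)"
    then obtain l u v where l: "K = l \<inter> S" "l \<in> lines M" "u \<in> l \<inter> S" "v \<in> l \<inter> S" "u \<noteq> v"
      unfolding lines_restriction[OF S] by blast
    then obtain k where k: "k \<in> \<Lambda>" "u \<in> k" "v \<in> k" using join[of u v] by blast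
    then have "k \<in> lines M" using L by blast
    then have "k = l" using line_unique[of k l u v] k l by blast
    then show "K \<in> ?L" using k l by blast
  next
    fix K assume "K \<in> ?L"
    then obtain l where l: "l \<in> \<Lambda>" "K = l \<inter> S" by blast
    have "card K \<noteq> 0" "card K \<noteq> 1" using card[OF l(1)] l(2) N by auto
    then obtain u v where "u \<in> K" "v \<in> K" "u \<noteq> v"
      by (metis One_nat_def card.empty card.insert card_gt_0_iff empty_iff finite.emptyI insertI1
          is_singletonI' is_singleton_altdef neq0_conv)
    then show "K \<in> lines (restriction M S)"
      unfolding lines_restriction[OF S] using l L by blast
  qed
  have uniq: "l = k" if "l \<in> \<Lambda>" "k \<in> \<Lambda>" "x \<in> l" "y \<in> l" "x \<in> k" "y \<in> k" "x \<noteq> y" for l k x y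
    using line_unique[of l k x y] that L by blast
  have "projective_plane S ?L"
    unfolding projective_plane_def
  proof (intro conjI ballI impI)
    fix l assume "l \<in> ?L" then show "l \<subseteq> S" by blast
  next
    fix x y assume xy: "x \<in> S" "y \<in> S" "x \<noteq> y"
    obtain l where l: "l \<in> \<Lambda>" "x \<in> l" "y \<in> l" using join xy by blast
    show "\<exists>!K. K \<in> ?L \<and> x \<in> K \<and> y \<in> K"
    proof (intro ex1I[of _ "l \<inter> S"])
      fix K assume "K \<in> ?L \<and> x \<in> K \<and> y \<in> K"
      then show "K = l \<inter> S" using uniq[OF _ l(1) _ _ l(2,3) xy(3)] by blast
    qed (use l xy in blast)
  next
    fix l' k' assume "l' \<in> ?L" "k' \<in> ?L" and ne: "l' \<noteq> k'"
    then obtain l k where lk: "l \<in> \<Lambda>" "k \<in> \<Lambda>" "l' = l \<inter> S" "k' = k \<inter> S" by blast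
    then have lk_ne: "l \<noteq> k" using ne by blast
    then obtain P where P: "P \<in> S" "P \<in> l" "P \<in> k" using meet[OF lk(1,2)] by blast
    show "\<exists>!x. x \<in> l' \<and> x \<in> k'"
    proof (intro ex1I[of _ P])
      show "P \<in> l' \<and> P \<in> k'" using lk P by blast
      fix x assume "x \<in> l' \<and> x \<in> k'"
      then show "x = P" using uniq[OF lk(1,2) _ P(2) _ P(3)] lk lk_ne by blast
    qed
  next
    have "card (Q \<inter> (l \<inter> S)) \<le> 2" if "l \<in> \<Lambda>" for l
    proof -
      have "Q \<inter> (l \<inter> S) = Q \<inter> l" using Q(1) by blast
      then show ?thesis using Q(3)[of l] that L by auto
    qed
    then show "\<exists>Q\<subseteq>S. card Q = 4 \<and> (\<forall>L\<in>?L. card (Q \<inter> L) \<le> 2)"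
      using Q(1,2) by (intro exI[of _ Q]) simp
  qed
  then show ?thesis
    unfolding is_projective_plane_of_order_def projective_plane_of_order_def lines
    using card by simp
qed

text \<open>In a projective plane with at least three points on each line, a quadrangle for a given collinear
triple can be drawn inside the plane. Its conjugate is therefore a point of the plane, and by
uniqueness it is the conjugate in \<open>M\<close>.\<close>

lemma projective_plane_harm_closed:
  assumes S: "S \<subseteq> E" and plane: "is_projective_plane_of_order M S N" and N: "N \<ge> 2"
  shows "harm_closed S"
  unfolding harm_closed_def
proof (intro ballI allI impI)
  note pl = plane[unfolded is_projective_plane_of_order_def projective_plane_of_order_def
    projective_plane_def]
  note pl_meet = pl[THEN conjunct1, THEN conjunct2, THEN conjunct2, THEN conjunct1, rule_format]
    and pl_quad = pl[THEN conjunct1, THEN conjunct2, THEN conjunct2, THEN conjunct2]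
    and pl_card = pl[THEN conjunct2, rule_format]
  have L: "l \<inter> S \<in> lines (restriction M S)"
    if "l \<in> lines M" "u \<in> l" "v \<in> l" "u \<in> S" "v \<in> S" "u \<noteq> v" for l u v
    unfolding lines_restriction[OF S] using that by blast
  have meet: "\<exists>P\<in>S. P \<in> l \<and> P \<in> k"
    if l: "l \<in> lines M" "u \<in> l" "v \<in> l" "u \<in> S" "v \<in> S" "u \<noteq> v"
      and k: "k \<in> lines M" "u' \<in> k" "v' \<in> k" "u' \<in> S" "v' \<in> S" "u' \<noteq> v'" for l u v k u' v'
  proof (cases "l \<inter> S = k \<inter> S")
    case True
    then show ?thesis using l by blast
  next
    case False
    have "\<exists>x. x \<in> l \<inter> S \<and> x \<in> k \<inter> S"
      using pl_meet[OF L[OF l] L[OF k] False] by (rule ex1_implies_ex)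
    then show ?thesis by blast
  qed
  fix y z x x' assume yzx: "y \<in> S" "z \<in> S" "x \<in> S" and h: "harm_conj M y z x x'"
  obtain l where l: "l \<in> lines M" "y \<in> l" "z \<in> l" "x \<in> l" "distinct [y, z, x]"
    using harm_conjD[OF h] by (metis insert_subset)
  have ds: "y \<noteq> z" "y \<noteq> x" "z \<noteq> x" using l(5) by auto
  \<comment> \<open>A point off the line exists because four points in general position do.\<close>
  obtain s where s: "s \<in> S" "s \<notin> l"
  proof -
    obtain Q where Q: "Q \<subseteq> S" "card Q = 4" "\<forall>L\<in>lines (restriction M S). card (Q \<inter> L) \<le> 2"
      using pl_quad by (elim exE conjE)
    have "card (Q \<inter> (l \<inter> S)) \<le> 2" using Q(3) L[OF l(1-3) yzx(1,2) ds(1)] by (rule bspec)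
    then have "\<not> Q \<subseteq> l" using Q by (auto simp: Int_absorb2 le_infI)
    then show ?thesis using that Q(1) by blast
  qed
  have E: "y \<in> E" "z \<in> E" "x \<in> E" "s \<in> E" using yzx s(1) S by auto
  have sne: "s \<noteq> y" "s \<noteq> z" "s \<noteq> x" using s l by auto
  obtain l6 where l6: "l6 \<in> lines M" "x \<in> l6" "s \<in> l6" using line_exists[OF E(3,4)] sne by metis
  obtain q where q: "q \<in> l6" "q \<in> S" "q \<noteq> x" "q \<noteq> s"
  proof -
    have "finite (l6 \<inter> S)" "card (l6 \<inter> S) = N + 1"
      using pl_card[OF L[OF l6 yzx(3) s(1) sne(3)[symmetric]]] by auto
    then have "\<not> l6 \<inter> S \<subseteq> {x, s}" using card_mono[of "{x, s}" "l6 \<inter> S"] N sne by auto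
    then show ?thesis using that by blast
  qed
  note U = line_unique
  have l6l: "l6 \<noteq> l" using s l6 by blast
  have q_l: "q \<notin> l" using U[OF l6(1) l(1) l6(2) q(1) l(4)] q l6l by blast
  have yz6: "y \<notin> l6" "z \<notin> l6"
    using U[OF l6(1) l(1) _ l6(2) _ l(4)] l(2,3) ds l6l by metis+
  have qE: "q \<in> E" and qne: "q \<noteq> y" "q \<noteq> z" using q S q_l l by auto
  obtain l1 where l1: "l1 \<in> lines M" "y \<in> l1" "q \<in> l1" using line_exists[OF E(1) qE] qne by metis
  obtain l2 where l2: "l2 \<in> lines M" "y \<in> l2" "s \<in> l2" using line_exists[OF E(1,4)] sne by metis
  obtain l3 where l3: "l3 \<in> lines M" "z \<in> l3" "s \<in> l3" using line_exists[OF E(2,4)] sne by metis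
  obtain l4 where l4: "l4 \<in> lines M" "z \<in> l4" "q \<in> l4" using line_exists[OF E(2) qE] qne by metis
  obtain p where p: "p \<in> S" "p \<in> l1" "p \<in> l3"
    using meet[OF l1 yzx(1) q(2) _ l3 yzx(2) s(1)] qne sne by metis
  obtain r where r: "r \<in> S" "r \<in> l2" "r \<in> l4"
    using meet[OF l2 yzx(1) s(1) _ l4 yzx(2) q(2)] qne sne by metis
  have l12: "l1 \<noteq> l2" using U[OF l1(1) l6(1) l1(3) _ q(1) l6(3)] l1 l2 q yz6 by metis
  have "p \<noteq> y" using U[OF l3(1) l(1) l3(2) _ l(3,2)] p l3 s ds by metis
  moreover have "r \<noteq> y" using U[OF l4(1) l(1) l4(2) _ l(3,2)] r l4 q_l ds by metis
  moreover have "p \<noteq> q" using U[OF l3(1) l6(1) _ l3(3) q(1) l6(3)] p l3 yz6 q by metis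
  moreover have "r \<noteq> s" using U[OF l4(1) l6(1) _ l4(3) l6(3) q(1)] r l4 yz6 q by metis
  ultimately have hp: "HP M y x z p q r s"
    using HP_I[OF l1(1) l2(1) l3(1) l4(1) l(1) l6(1) l1(2) p(2) l1(3) l2(2) r(2) l2(3)
      l3(2) p(3) l3(3) l4(2,3) r(3) l(4,2,3) l6(2) q(1) l6(3) l12] qne sne by metis
  then have "p \<noteq> r" using HP_lines(1) by fastforce
  moreover have "p \<in> E" "r \<in> E" using p r S by auto
  ultimately obtain k where k: "k \<in> lines M" "p \<in> k" "r \<in> k" using line_exists by metis
  obtain x'' where x'': "x'' \<in> S" "x'' \<in> l" "x'' \<in> k"
    using meet[OF l(1-3) yzx(1,2) ds(1) k p(1) r(1) \<open>p \<noteq> r\<close>] by blast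
  have "harm_conj M y z x x''" using harm_conjI[OF hp l(1-3) k x''(2,3)] .
  then show "x' \<in> S" using harm_conj_unique[OF h] x''(1) by simp
qed

lemma harm_step_mono: "X \<subseteq> harm_step M X"
  unfolding harm_step_def by blast

lemma harm_closure_superset: "X \<subseteq> harm_closure M X"
  using UN_upper[of 0 UNIV "\<lambda>n. (harm_step M ^^ n) X"] unfolding harm_closure_def by simp

lemma harm_closure_closed: "harm_closed (harm_closure M X)"
  unfolding harm_closed_def
proof (intro ballI allI impI)
  let ?f = "\<lambda>n. (harm_step M ^^ n) X"
  have mono: "?f i \<subseteq> ?f j" if "i \<le> j" for i j
    by (rule lift_Suc_mono_le[OF _ that]) (simp add: harm_step_mono)
  fix y z x x' assume "y \<in> harm_closure M X" "z \<in> harm_closure M X" "x \<in> harm_closure M X"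
    and h: "harm_conj M y z x x'"
  then obtain i j k where "y \<in> ?f i" "z \<in> ?f j" "x \<in> ?f k" unfolding harm_closure_def by blast
  then have *: "y \<in> ?f (i + j + k)" "z \<in> ?f (i + j + k)" "x \<in> ?f (i + j + k)"
    using mono[of i "i + j + k"] mono[of j "i + j + k"] mono[of k "i + j + k"] by auto
  obtain l where "l \<in> lines M" "{y, z, x, x'} \<subseteq> l" using harm_conjD[OF h] .
  then have "x' \<in> E" using line_ground by blast
  then have "x' \<in> ?f (Suc (i + j + k))" using * h by (auto simp: harm_step_def)
  then show "x' \<in> harm_closure M X" unfolding harm_closure_def by blast
qed

lemma harm_closure_least:
  assumes "X \<subseteq> S" "harm_closed S"
  shows "harm_closure M X \<subseteq> S"
proof -
  have "(harm_step M ^^ i) X \<subseteq> S" for i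
  proof (induction i)
    case (Suc i)
    then show ?case using harm_closedD[OF assms(2)] by (auto simp: harm_step_def subset_iff)
  qed (use assms in simp)
  then show ?thesis unfolding harm_closure_def by blast
qed

end

context coordinate_frame
begin

text \<open>The quadrangle consists of two points on \<open>LA\<close> and two on \<open>LB\<close>: a line with three of them would
be one of these two lines.\<close>

lemma plane: "is_projective_plane_of_order M points (nat n)"
proof (rule projective_planeI[where \<Lambda> = plane_lines and Q = "{A 0, A 1, B 0, B 1}"])
  show "points \<subseteq> E"
    using line_ground lines3(1) d(1) A(1) coords_ground[OF G(2)] unfolding points_def by blast
  show "plane_lines \<subseteq> lines M" using lines3 R m unfolding plane_lines_def by blast
  have "B t = G t 0" for t using coords_unique[OF coords_B G(2)] .
  then show "{A 0, A 1, B 0, B 1} \<subseteq> points" using pointsI by simp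
  have ne: "A 0 \<noteq> A 1" "B 0 \<noteq> B 1" using A_eq[of 1 0] B_eq[of 1 0] not_dvd_1 by auto
  have AB: "A i \<noteq> B j" for i j using A_not_LB B(1) by metis
  then show "card {A 0, A 1, B 0, B 1} = 4" using ne by simp
  fix l assume l: "l \<in> lines M"
  have a: "l = LA" if "A 0 \<in> l" "A 1 \<in> l" using line_unique[OF l lines3(1) that A(1) A(1) ne(1)] .
  have b: "l = LB" if "B 0 \<in> l" "B 1 \<in> l" using line_unique[OF l lines3(2) that B(1) B(1) ne(2)] .
  have "{A 0, A 1, B 0, B 1} \<inter> l \<subseteq> {A 0, A 1} \<or> {A 0, A 1, B 0, B 1} \<inter> l \<subseteq> {B 0, B 1}
    \<or> (\<exists>i j. {A 0, A 1, B 0, B 1} \<inter> l \<subseteq> {A i, B j})"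
  proof (cases "A 0 \<in> l \<and> A 1 \<in> l")
    case True
    then show ?thesis using a B_not_LA by auto
  next
    case False
    then obtain i where i: "{A 0, A 1} \<inter> l \<subseteq> {A i}" by blast
    show ?thesis
    proof (cases "B 0 \<in> l \<and> B 1 \<in> l")
      case True
      then show ?thesis using b A_not_LB by auto
    next
      case False
      then obtain j where "{B 0, B 1} \<inter> l \<subseteq> {B j}" by blast
      then have "{A 0, A 1, B 0, B 1} \<inter> l \<subseteq> {A i, B j}" using i by blast
      then show ?thesis by blast
    qed
  qed
  moreover have "card X \<le> 2" if "X \<subseteq> {u, v}" for X and u v :: 'a
    using card_mono[OF _ that] by (cases "u = v") auto
  ultimately show "card ({A 0, A 1, B 0, B 1} \<inter> l) \<le> 2" by blast
qed (use join meet line_card n2 in auto)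

text \<open>The plane contains the seven initial points and is closed under conjugation; conversely all its
points were found in \<open>K\<close>.\<close>

lemma points_eq:
  assumes "K = harm_closure M {d, B 0, B 1, C 1, C 0, A 1, A 0}"
  shows "K = points"
proof
  have "B t = G t 0" "C t = G t 1" for t
    using coords_unique[OF coords_B G(2)] coords_unique[OF coords_C G(2)] by auto
  then have X: "{d, B 0, B 1, C 1, C 0, A 1, A 0} \<subseteq> points" using pointsI by simp
  have "points \<subseteq> E"
    using line_ground lines3(1) d(1) A(1) coords_ground[OF G(2)] unfolding points_def by blast
  then have "harm_closed points" using projective_plane_harm_closed[OF _ plane] n2 by simp
  then show "K \<subseteq> points" using harm_closure_least[OF X] assms by simp
  show "points \<subseteq> K" using K G(1) unfolding points_def by blast
qed

end

section \<open>The three concurrent lines\<close>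

context harmonic
begin

definition col :: "'a \<Rightarrow> 'a \<Rightarrow> 'a \<Rightarrow> bool" where
  "col u v w \<longleftrightarrow> (\<exists>l\<in>lines M. u \<in> l \<and> v \<in> l \<and> w \<in> l)"

lemma col_commute: "col u v w \<longleftrightarrow> col w v u"
  unfolding col_def by blast

lemma col_flip: "col u v w \<longleftrightarrow> col u w v"
  unfolding col_def by blast

lemma col_determines:
  assumes "col u v w" "col u v w'" "u \<noteq> v" "l \<in> lines M" "u \<notin> l" "w \<in> l" "w' \<in> l"
  shows "w = w'"
proof (rule ccontr)
  assume ne: "w \<noteq> w'"
  obtain g h where g: "g \<in> lines M" "u \<in> g" "v \<in> g" "w \<in> g"
    and h: "h \<in> lines M" "u \<in> h" "v \<in> h" "w' \<in> h"
    using assms(1,2) unfolding col_def by blast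
  have "g = h" using line_unique[OF g(1) h(1) g(2,3) h(2,3) assms(3)] .
  then have "g = l" using line_unique[OF g(1) assms(4) g(4) _ assms(6,7) ne] h by simp
  then show False using g assms(5) by simp
qed

end

text \<open>A conjugate sequence \<open>d, b 0, b 1, \<dots>\<close> on a line \<open>LB\<close> and two further lines \<open>LA\<close> and \<open>LC\<close> through \<open>d\<close>.
Interchanging \<open>LA\<close> and \<open>LC\<close> gives such a frame again, so what is proved for one of them holds for
the other.\<close>

locale conjugate_frame = harmonic M
  for M :: "'a matroid" +
  fixes d :: 'a and b :: "nat \<Rightarrow> 'a" and LA LB LC :: "'a set"
  assumes conj: "harm_conj M d (b (i + 1)) (b i) (b (i + 2))"
    and lines3: "LA \<in> lines M" "LB \<in> lines M" "LC \<in> lines M" "LA \<noteq> LB" "LA \<noteq> LC" "LB \<noteq> LC"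
    and d: "d \<in> LA" "d \<in> LB" "d \<in> LC"
    and b: "b i \<in> LB"
begin

lemma b_ne: "b i \<noteq> d" "b (i + 1) \<noteq> b i"
  using harm_conjD[OF conj[of i]] by (metis distinct_length_2_or_more)+

lemma meet_d:
  "P \<in> LA \<Longrightarrow> P \<in> LB \<Longrightarrow> P = d" "P \<in> LA \<Longrightarrow> P \<in> LC \<Longrightarrow> P = d" "P \<in> LB \<Longrightarrow> P \<in> LC \<Longrightarrow> P = d"
  using line_unique lines3 d by metis+

text \<open>Projecting \<open>LB\<close> from a point of \<open>LA\<close> to \<open>LC\<close> and back from another one acts on the sequence as a
shift. If it takes \<open>b i\<close> to \<open>b (i + 1)\<close>, then it takes \<open>b (i + 1)\<close> to their harmonic conjugate
\<open>b (i + 2)\<close>, because the two centres and the two points of \<open>LC\<close> form a quadrangle for it.\<close>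

lemma translate:
  assumes p: "p \<in> LA" "p \<noteq> d" and q: "q \<in> LA" "q \<noteq> d" and r: "r \<in> LC" "r \<noteq> d"
    and s: "s \<in> LC" "s \<noteq> d" and ne: "p \<noteq> q" "r \<noteq> s"
    and c: "col q (b i) s" "col p (b (i + 1)) s" "col q (b (i + 1)) r"
  shows "col p (b (i + 2)) r"
proof -
  obtain l3 where l3: "l3 \<in> lines M" "p \<in> l3" "b (i + 1) \<in> l3" "s \<in> l3" using c unfolding col_def by blast
  obtain l4 where l4: "l4 \<in> lines M" "q \<in> l4" "b (i + 1) \<in> l4" "r \<in> l4" using c unfolding col_def by blast
  obtain l6 where l6: "l6 \<in> lines M" "q \<in> l6" "b i \<in> l6" "s \<in> l6" using c unfolding col_def by blast
  have hp: "HP M d (b i) (b (i + 1)) p q r s"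
    using HP_I[OF lines3(1,3) l3(1) l4(1) lines3(2) l6(1) d(1) p(1) q(1) d(3) r(1) s(1) l3(3,2,4)
      l4(3,2,4) b d(2) b l6(3,2,4) lines3(5)] p q r s ne by metis
  have "p \<noteq> r" using meet_d(2) p r by blast
  then obtain k where k: "k \<in> lines M" "p \<in> k" "r \<in> k"
    using line_exists[of p r] line_ground[OF lines3(1) p(1)] line_ground[OF lines3(3) r(1)] by metis
  obtain x' where x': "LB \<inter> k = {x'}" "harm_conj M d (b (i + 1)) (b i) x'"
    using harm_conj_meet[OF hp lines3(2) d(2) b k] .
  then have "b (i + 2) \<in> k" using harm_conj_unique[OF conj] by blast
  then show ?thesis using k unfolding col_def by blast
qed

text \<open>The projection of \<open>b (i + 2)\<close> from \<open>a0\<close> to \<open>LC\<close> exists since it is the harmonic conjugate of the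
previous two points on \<open>LC\<close>, with the quadrangle \<open>a0, a1, b (i + 2), b (i + 1)\<close>. As a conjugate it
lies in \<open>K\<close>.\<close>

lemma chain_step:
  assumes K: "harm_closed K" "d \<in> K" "c \<in> K" "c' \<in> K"
    and a: "a0 \<in> LA" "a0 \<noteq> d" "a1 \<in> LA" "a1 \<noteq> d" "a0 \<noteq> a1"
    and c: "c \<in> LC" "c \<noteq> d" "c' \<in> LC" "c' \<noteq> d"
    and h: "col a1 (b (i + 1)) c" "col a0 (b (i + 1)) c'" "col a1 (b (i + 2)) c'"
  shows "\<exists>c''\<in>K. c'' \<in> LC \<and> c'' \<noteq> d \<and> col a0 (b (i + 2)) c'' \<and> col a1 (b (i + 3)) c''"
proof -
  obtain l3 where l3: "l3 \<in> lines M" "a0 \<in> l3" "b (i + 1) \<in> l3" "c' \<in> l3" using h unfolding col_def by blast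
  obtain l4 where l4: "l4 \<in> lines M" "a1 \<in> l4" "b (i + 2) \<in> l4" "c' \<in> l4" using h unfolding col_def by blast
  obtain l6 where l6: "l6 \<in> lines M" "a1 \<in> l6" "b (i + 1) \<in> l6" "c \<in> l6" using h unfolding col_def by blast
  have bb: "b (i + 2) \<noteq> b (i + 1)" using b_ne(2)[of "i + 1"] by (simp add: add.assoc)
  have hp: "HP M d c c' a0 a1 (b (i + 2)) (b (i + 1))"
    using HP_I[OF lines3(1,2) l3(1) l4(1) lines3(3) l6(1) d(1) a(1,3) d(2) b b l3(4,2,3) l4(4,2,3)
      c(1) d(3) c(3) l6(4,2,3) lines3(4)] a b_ne bb by metis
  have "a0 \<noteq> b (i + 2)" using meet_d(1) a b by metis
  then obtain k where k: "k \<in> lines M" "a0 \<in> k" "b (i + 2) \<in> k"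
    using line_exists[of a0 "b (i + 2)"] line_ground[OF lines3(1) a(1)] line_ground[OF lines3(2) b] by metis
  obtain c'' where c'': "LC \<inter> k = {c''}" "harm_conj M d c' c c''"
    using harm_conj_meet[OF hp lines3(3) d(3) c(3) k] .
  have inK: "c'' \<in> K" using harm_closedD[OF K(1) c''(2) K(2,4,3)] .
  have ne: "c'' \<noteq> d" "c'' \<noteq> c'" using harm_conjD[OF c''(2)] by metis+
  have cl: "c'' \<in> LC" "col a0 (b (i + 2)) c''" using c''(1) k unfolding col_def by blast+
  have "col a1 (b (i + 1 + 2)) c''"
    using translate[OF a(3,4,1,2) cl(1) ne(1) c(3,4) a(5)[symmetric] ne(2), of "i + 1"] h cl
    by (simp add: add.assoc)
  moreover have "i + 1 + 2 = i + 3" by simp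
  ultimately have "col a1 (b (i + 3)) c''" by (simp only:)
  then show ?thesis using inK cl ne by blast
qed

lemma chain:
  assumes K: "harm_closed K" "d \<in> K" "c0 \<in> K" "c1 \<in> K"
    and a: "a0 \<in> LA" "a0 \<noteq> d" "a1 \<in> LA" "a1 \<noteq> d" "a0 \<noteq> a1"
    and c: "c0 \<in> LC" "c0 \<noteq> d" "c1 \<in> LC" "c1 \<noteq> d"
    and h: "col a0 (b 0) c0" "col a1 (b 1) c0" "col a0 (b 1) c1" "col a1 (b 2) c1"
  shows "\<exists>c\<in>K. c \<in> LC \<and> c \<noteq> d \<and> col a0 (b k) c \<and> col a1 (b (k + 1)) c" (is "?P k")
proof -
  have "?P k \<and> ?P (k + 1)"
  proof (induction k)
    case 0
    have "col a1 (b (1 + 1)) c1" using h(4) by (simp only: one_add_one)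
    then show ?case using K c h by auto
  next
    case (Suc k)
    then obtain c c' where c1: "c \<in> K" "c \<in> LC" "c \<noteq> d" "col a1 (b (k + 1)) c"
      and c2: "c' \<in> K" "c' \<in> LC" "c' \<noteq> d" "col a0 (b (k + 1)) c'" "col a1 (b (k + 1 + 1)) c'"
      by blast
    have e: "k + 1 + 1 = k + 2" "Suc k + 1 = k + 2" "k + 2 + 1 = k + 3" by simp_all
    have "?P (Suc k + 1)" unfolding e
      using chain_step[OF K(1,2) c1(1) c2(1) a c1(2,3) c2(2,3) c1(4) c2(4) c2(5)[unfolded e(1)]] .
    then show ?case using Suc by simp
  qed
  then show ?thesis by simp
qed

end

lemma (in conjugate_frame) swap: "conjugate_frame M d b LC LB LA"
  by unfold_locales (use conj lines3 d b in auto)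

text \<open>The quadrangle that witnesses the first conjugation \<open>b 0, b 1, b 2\<close> provides both auxiliary lines,
with two points on each of them.\<close>

lemma (in harmonic) conjugate_frame_of_modular:
  assumes ms: "modular_sequence M d b n"
  obtains LA LB LC a0 a1 c0 c1 where "conjugate_frame M d b LA LB LC"
    "a0 \<in> LA" "a0 \<noteq> d" "a1 \<in> LA" "a1 \<noteq> d" "a0 \<noteq> a1"
    "c0 \<in> LC" "c0 \<noteq> d" "c1 \<in> LC" "c1 \<noteq> d" "c0 \<noteq> c1"
    "col a0 (b 0) c0" "col a1 (b 1) c0" "col a0 (b 1) c1" "col a1 (b 2) c1"
proof -
  have "\<forall>i\<ge>1. harm_conj M d (b i) (b (i - 1)) (b (i + 1))"
    using ms by (simp add: modular_sequence_def conjugate_sequence_def)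
  then have conj: "harm_conj M d (b (i + 1)) (b i) (b (i + 2))" for i
    by (drule_tac x = "i + 1" in spec) (simp add: add.assoc)
  have "harm_conj M d (b 1) (b 0) (b 2)" using conj[of 0] by (simp add: numeral_2_eq_2)
  then obtain p q r s where hp: "HP M d (b 0) (b 1) p q r s"
    and b2: "clo {d, b 1} \<inter> clo {p, r} = {b 2}" unfolding harm_conj_def by blast
  note dist = HP_lines(1)[OF hp] and SE = HP_lines(2)[OF hp]
  let ?S = "{d, b 0, b 1, p, q, r, s}"
  obtain LB where LB: "LB \<in> lines M" "LB \<inter> ?S = {d, b 0, b 1}" using HP_lines(3)[OF hp] by blast
  obtain LC where LC: "LC \<in> lines M" "LC \<inter> ?S = {d, p, q}" using HP_lines(4)[OF hp] by blast
  obtain LA where LA: "LA \<in> lines M" "LA \<inter> ?S = {d, r, s}" using HP_lines(5)[OF hp] by blast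
  obtain l3 where l3: "l3 \<in> lines M" "l3 \<inter> ?S = {b 1, p, s}" using HP_lines(7)[OF hp] by blast
  obtain l4 where l4: "l4 \<in> lines M" "l4 \<inter> ?S = {b 1, q, r}" using HP_lines(8)[OF hp] by blast
  obtain l6 where l6: "l6 \<in> lines M" "l6 \<inter> ?S = {b 0, q, s}" using HP_lines(6)[OF hp] by blast
  have "s \<in> l6 \<and> b 0 \<in> l6 \<and> q \<in> l6" using l6(2) by auto
  moreover have "r \<in> l4 \<and> b 1 \<in> l4 \<and> q \<in> l4" using l4(2) by auto
  moreover have "s \<in> l3 \<and> b 1 \<in> l3 \<and> p \<in> l3" using l3(2) by auto
  ultimately have col: "col s (b 0) q" "col r (b 1) q" "col s (b 1) p"
    unfolding col_def using l6(1) l4(1) l3(1) by (auto intro: bexI)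
  have pr: "p \<in> E" "r \<in> E" "p \<noteq> r" using SE dist by auto
  have "p \<in> clo {p, r}" "r \<in> clo {p, r}" "b 2 \<in> clo {p, r}"
    using cl_ext[of "{p, r}"] pr b2 by auto
  then have col2: "col r (b 2) p" unfolding col_def using line_through[OF pr] by blast
  have "p \<notin> LA \<inter> ?S" "p \<notin> LB \<inter> ?S" "r \<notin> LB \<inter> ?S"
    unfolding LA(2) LB(2) using dist by auto
  then have n: "p \<notin> LA" "p \<notin> LB" "r \<notin> LB" by auto
  have i: "d \<in> LA" "r \<in> LA" "s \<in> LA" "d \<in> LB" "b 0 \<in> LB" "b 1 \<in> LB" "d \<in> LC" "p \<in> LC" "q \<in> LC"
    using equalityD2[OF LA(2)] equalityD2[OF LB(2)] equalityD2[OF LC(2)]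
    by (simp_all only: insert_subset Int_iff)
  have b_LB: "b k \<in> LB \<and> b (k + 1) \<in> LB" for k
  proof (induction k)
    case 0
    show ?case using i by simp
  next
    case (Suc k)
    obtain l where l: "l \<in> lines M" "{d, b (k + 1), b k, b (k + 2)} \<subseteq> l" "distinct [d, b (k + 1), b k]"
      using harm_conjD[OF conj[of k]] by metis
    then have "l = LB" using line_unique[OF l(1) LB(1), of d "b (k + 1)"] i Suc by auto
    then show ?case using l(2) Suc by simp
  qed
  have "conjugate_frame M d b LA LB LC"
    using conj LA(1) LB(1) LC(1) n i b_LB by unfold_locales auto
  moreover have "s \<noteq> d" "r \<noteq> d" "s \<noteq> r" "q \<noteq> d" "p \<noteq> d" "q \<noteq> p" using dist by auto
  ultimately show ?thesis
    by (intro that[of LA LB LC s r q p]) (use i col col2 in simp_all)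
qed

context conjugate_frame
begin

text \<open>The chains on \<open>LC\<close> and \<open>LA\<close> are determined by the sequence \<open>b\<close> through projection, so the three
sequences have the same coincidences, and the shift is reversible. Hence the first repetition is
\<open>b n = b 0\<close>, the sequences have period \<open>n\<close>, and they can be indexed by integers modulo \<open>n\<close>.\<close>

lemma coordinate_frame_of_modular:
  assumes K: "harm_closed K" "{d, b 0, b 1, c1, c0, a1, a0} \<subseteq> K"
    and a: "a0 \<in> LA" "a0 \<noteq> d" "a1 \<in> LA" "a1 \<noteq> d" "a0 \<noteq> a1"
    and c: "c0 \<in> LC" "c0 \<noteq> d" "c1 \<in> LC" "c1 \<noteq> d" "c0 \<noteq> c1"
    and h: "col a0 (b 0) c0" "col a1 (b 1) c0" "col a0 (b 1) c1" "col a1 (b 2) c1"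
    and ms: "modular_sequence M d b n"
  obtains A B C where "coordinate_frame M K (int n) d A B C LA LB LC"
    "B 0 = b 0" "B 1 = b 1" "C 0 = c0" "C 1 = c1" "A 0 = a0" "A 1 = a1"
proof -
  interpret swap: conjugate_frame M d b LC LB LA by (rule swap)
  have K': "d \<in> K" "b 0 \<in> K" "b 1 \<in> K" "c1 \<in> K" "c0 \<in> K" "a1 \<in> K" "a0 \<in> K" using K(2) by auto
  have "\<forall>k. \<exists>x. x \<in> K \<and> x \<in> LC \<and> x \<noteq> d \<and> col a0 (b k) x \<and> col a1 (b (k + 1)) x"
    using chain[OF K(1) K'(1,5,4) a c(1-4) h] by blast
  then obtain cc where "\<forall>k. cc k \<in> K \<and> cc k \<in> LC \<and> cc k \<noteq> d \<and> col a0 (b k) (cc k) \<and> col a1 (b (k + 1)) (cc k)"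
    by (rule choice[THEN exE])
  then have cc: "cc k \<in> K" "cc k \<in> LC" "cc k \<noteq> d" "col a0 (b k) (cc k)" "col a1 (b (k + 1)) (cc k)" for k
    by auto
  have h': "col c0 (b 0) a0" "col c1 (b 1) a0" "col c0 (b 1) a1" "col c1 (b 2) a1"
    using h by (simp_all only: col_commute[of c0] col_commute[of c1])
  have "\<forall>k. \<exists>x. x \<in> K \<and> x \<in> LA \<and> x \<noteq> d \<and> col c0 (b k) x \<and> col c1 (b (k + 1)) x"
    using swap.chain[OF K(1) K'(1,7,6) c a(1-4) h'] by blast
  then obtain aa where "\<forall>k. aa k \<in> K \<and> aa k \<in> LA \<and> aa k \<noteq> d \<and> col c0 (b k) (aa k) \<and> col c1 (b (k + 1)) (aa k)"
    by (rule choice[THEN exE])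
  then have aa: "aa k \<in> K" "aa k \<in> LA" "aa k \<noteq> d" "col c0 (b k) (aa k)" "col c1 (b (k + 1)) (aa k)" for k
    by auto
  have out: "a0 \<notin> LB" "a1 \<notin> LB" "c0 \<notin> LB" "a0 \<notin> LC" "a1 \<notin> LC" "c0 \<notin> LA" "c1 \<notin> LA"
    using meet_d a c by blast+
  have bne: "a0 \<noteq> b k" "a1 \<noteq> b k" "c0 \<noteq> b k" "c1 \<noteq> b k" for k
    using out b[of k] meet_d c by metis+
  \<comment> \<open>Projection between \<open>LB\<close> and \<open>LC\<close> from \<open>a0\<close> and from \<open>a1\<close> is injective; comparing the two gives \<open>shift\<close>.\<close>
  have cb: "cc i = cc j \<longleftrightarrow> b i = b j" for i j
  proof
    assume e: "cc i = cc j"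
    have "col a0 (cc i) (b i)" "col a0 (cc i) (b j)"
      using cc(4)[of i] cc(4)[of j] e col_flip by metis+
    moreover have "a0 \<noteq> cc i" using out(4) cc(2)[of i] by metis
    ultimately show "b i = b j" using col_determines lines3(2) out(1) b by metis
  next
    assume "b i = b j"
    then show "cc i = cc j"
      using col_determines[OF cc(4)[of i] _ bne(1) lines3(3) out(4) cc(2) cc(2)] cc(4)[of j] by simp
  qed
  have cb1: "cc i = cc j \<longleftrightarrow> b (i + 1) = b (j + 1)" for i j
  proof
    assume e: "cc i = cc j"
    have "col a1 (cc i) (b (i + 1))" "col a1 (cc i) (b (j + 1))"
      using cc(5)[of i] cc(5)[of j] e col_flip by metis+
    moreover have "a1 \<noteq> cc i" using out(5) cc(2)[of i] by metis
    ultimately show "b (i + 1) = b (j + 1)" using col_determines lines3(2) out(2) b by metis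
  next
    assume "b (i + 1) = b (j + 1)"
    then show "cc i = cc j"
      using col_determines[OF cc(5)[of i] _ bne(2) lines3(3) out(5) cc(2) cc(2)] cc(5)[of j] by simp
  qed
  have ab: "aa i = aa j \<longleftrightarrow> b i = b j" for i j
  proof
    assume e: "aa i = aa j"
    have "col c0 (aa i) (b i)" "col c0 (aa i) (b j)"
      using aa(4)[of i] aa(4)[of j] e col_flip by metis+
    moreover have "c0 \<noteq> aa i" using out(6) aa(2)[of i] by metis
    ultimately show "b i = b j" using col_determines lines3(2) out(3) b by metis
  next
    assume "b i = b j"
    then show "aa i = aa j"
      using col_determines[OF aa(4)[of i] _ bne(3) lines3(1) out(6) aa(2) aa(2)] aa(4)[of j] by simp
  qed
  have shift: "b i = b j \<longleftrightarrow> b (i + 1) = b (j + 1)" for i j using cb cb1 by metis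
  have c0: "cc 0 = c0" using col_determines[OF cc(4) h(1) bne(1) lines3(3) out(4) cc(2) c(1)] .
  have c1: "cc 1 = c1" using col_determines[OF cc(4) h(3) bne(1) lines3(3) out(4) cc(2) c(3)] .
  have a0: "aa 0 = a0" using col_determines[OF aa(4) h'(1) bne(3) lines3(1) out(6) aa(2) a(1)] .
  have a1: "aa 1 = a1" using col_determines[OF aa(4) h'(3) bne(3) lines3(1) out(6) aa(2) a(3)] .
  have grid: "col (aa i) (b (i + k)) (cc k)" for i k
  proof (induction i arbitrary: k)
    case 0
    show ?case using cc(4)[of k] a0 by simp
  next
    case (Suc i)
    note left = Suc.IH
    show ?case
    proof (induction k)
      case 0
      show ?case using aa(4)[of "Suc i"] c0 col_commute by simp
    next
      case (Suc k)
      have ne: "aa (Suc i) \<noteq> aa i" "cc (Suc k) \<noteq> cc k" using ab cb b_ne(2) by (metis Suc_eq_plus1)+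
      have "col (aa i) (b (i + k + 1)) (cc (Suc k))" using left[of "Suc k"] by simp
      moreover have "col (aa (Suc i)) (b (i + k + 1)) (cc k)" using Suc by simp
      ultimately have "col (aa (Suc i)) (b (i + k + 2)) (cc (Suc k))"
        using translate[OF aa(2,3) aa(2,3) cc(2,3) cc(2,3) ne left[of k]] by blast
      then show ?case by simp
    qed
  qed
  have first: "\<not> repeats_at d b k" if "k < n" for k
    using ms that by (simp add: modular_sequence_def)
  have inj: "b i = b j \<longleftrightarrow> i = j" if "i < n" "j < n" for i j
    using first[OF that(1)] first[OF that(2)] unfolding repeats_at_def
    by (metis imageI insertCI lessThan_iff linorder_neqE_nat)
  have rep: "b n = d \<or> (\<exists>j<n. b n = b j)"
    using ms by (auto simp: modular_sequence_def repeats_at_def)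
  then obtain j where j: "j < n" "b n = b j" using b_ne(1) by blast
  have "j = 0"
  proof (rule ccontr)
    assume "j \<noteq> 0"
    then have "b (n - 1) = b (j - 1)" using shift[of "n - 1" "j - 1"] j by simp
    moreover have "n - 1 < n" "j - 1 < n" using j(1) by linarith+
    ultimately have "n - 1 = j - 1" using inj by blast
    then show False using j(1) \<open>j \<noteq> 0\<close> by linarith
  qed
  then have bn: "b n = b 0" and n0: "n > 0" using j by auto
  have per1: "b (i + n) = b i" for i
    by (induction i) (use bn shift in auto)
  have per: "b (i + n * k) = b i" for i k
  proof (induction k)
    case (Suc k)
    have "i + n * Suc k = i + n * k + n" by simp
    then show ?case using per1[of "i + n * k"] Suc by (simp only:)
  qed simp
  have bmod: "b (i mod n) = b i" for i
    using per[of "i mod n" "i div n"] by simp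
  have n2: "n \<ge> 2"
  proof (rule ccontr)
    assume "\<not> n \<ge> 2"
    then have "n = 1" using n0 by simp
    then show False using bn b_ne(2)[of 0] by simp
  qed
  define red where "red i = nat (i mod int n)" for i
  have red: "red i < n" "int (red i) = i mod int n" for i
    unfolding red_def using n0 by (simp_all add: nat_less_iff)
  have red_eq: "red i = red j \<longleftrightarrow> int n dvd i - j" for i j
    using red(2)[of i] red(2)[of j] by (metis mod_eq_dvd_iff of_nat_eq_iff)
  have red01: "red 0 = 0" "red 1 = 1" unfolding red_def using n2 by auto
  have red_add: "red (i + j) = (red i + red j) mod n" for i j
  proof -
    have "int (red (i + j)) = int ((red i + red j) mod n)"
      by (simp add: red(2) of_nat_mod mod_simps)
    then show ?thesis by (simp only: of_nat_eq_iff)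
  qed
  have tr: "\<exists>l\<in>lines M. aa (red i) \<in> l \<and> b (red (i + j)) \<in> l \<and> cc (red j) \<in> l" for i j
    using grid[of "red i" "red j"] unfolding red_add bmod col_def .
  have bK: "b i \<in> K \<and> b (i + 1) \<in> K" for i
  proof (induction i)
    case (Suc i)
    then have "b (i + 2) \<in> K" using harm_closedD[OF K(1) conj[of i]] K' by blast
    then show ?case using Suc by simp
  qed (use K' in simp)
  have "coordinate_frame M K (int n) d (\<lambda>i. aa (red i)) (\<lambda>i. b (red i)) (\<lambda>i. cc (red i)) LA LB LC"
  proof
    show "aa (red i) = aa (red j) \<longleftrightarrow> int n dvd i - j" for i j
      using ab inj red(1) red_eq by metis
    show "b (red i) = b (red j) \<longleftrightarrow> int n dvd i - j" for i j
      using inj red(1) red_eq by metis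
  qed (use n2 K(1) K'(1) lines3 d aa cc b b_ne(1) bK tr in auto)
  then show ?thesis
    using that[of "\<lambda>i. aa (red i)" "\<lambda>i. b (red i)" "\<lambda>i. cc (red i)"] red01 a0 a1 c0 c1 by simp
qed

end

theorem proposition6p1:
  fixes M :: "'a matroid" and d :: 'a and b :: "nat \<Rightarrow> 'a" and n :: nat
  assumes "harmonic_matroid M"
    and "modular_sequence M d b n"
  shows "prime n \<and>
    (\<exists>c1 c0 a1 a0. {c1, c0, a1, a0} \<subseteq> ground M \<and>
       is_projective_plane_of_order M
         (harm_closure M {d, b 0, b 1, c1, c0, a1, a0}) n)"
proof -
  interpret harmonic M using assms(1) by unfold_locales
  obtain LA LB LC a0 a1 c0 c1 where s: "conjugate_frame M d b LA LB LC"
    and a: "a0 \<in> LA" "a0 \<noteq> d" "a1 \<in> LA" "a1 \<noteq> d" "a0 \<noteq> a1"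
    and c: "c0 \<in> LC" "c0 \<noteq> d" "c1 \<in> LC" "c1 \<noteq> d" "c0 \<noteq> c1"
    and h: "col a0 (b 0) c0" "col a1 (b 1) c0" "col a0 (b 1) c1" "col a1 (b 2) c1"
    using conjugate_frame_of_modular[OF assms(2)] .
  interpret conjugate_frame M d b LA LB LC by (rule s)
  let ?K = "harm_closure M {d, b 0, b 1, c1, c0, a1, a0}"
  obtain A B C where l: "coordinate_frame M ?K (int n) d A B C LA LB LC"
    and e: "B 0 = b 0" "B 1 = b 1" "C 0 = c0" "C 1 = c1" "A 0 = a0" "A 1 = a1"
    using coordinate_frame_of_modular[OF harm_closure_closed harm_closure_superset a c h assms(2)] .
  interpret L: coordinate_frame M ?K "int n" d A B C LA LB LC by (rule l)
  have "prime n" using L.n_prime by simp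
  moreover have "{c1, c0, a1, a0} \<subseteq> ground M"
    using line_ground[OF lines3(1)] line_ground[OF lines3(3)] a c by blast
  moreover have "?K = L.points" by (rule L.points_eq) (simp only: e)
  then have "is_projective_plane_of_order M ?K n" using L.plane by simp
  ultimately show ?thesis by blast
qed

end
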